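(* Let $n\ge 1$ and let $a$ and $b$ be non-zero elements of $\mathbb{C}_n^\perp\subset A_n$. If $\{a,b\}\in A_{n+1}$ does not belong to the $D$-locus, then $\mathrm{Ann}\{a,b\}$ is contained in $\mathbb{H}_{n+1}^\perp$. Moreover, the dimension of $\mathrm{Ann}\{a,b\}$ is $\dim\mathrm{Ann}(a)+\dim\mathrm{Ann}(b)$.
   Context: The Cayley-Dickson algebras $A_n$ are real algebras with involution defined inductively: $A_0=\mathbb{R}$ with trivial conjugation, and $A_n=A_{n-1}\times A_{n-1}$ additively, with $(a,b)^*=(a^*,-b)$ and $(a,b)(c,d)=(ac-d^*b,\;da+bc^* )$. For $n\ge 1$ put $i_n=(0,1)\in A_n$, and let $\mathbb{C}_n$ be the $\mathbb{R}$-linear span of $1=(1,0)$ and $i_n$. The real inner product is $\langle a,b\rangle_{\mathbb{R}}=\mathrm{Re}(ab^* )$, where $\mathrm{Re}(x)=\frac12(x+x^* )$; "orthogonal" and $\perp$ refer to it. The Hermitian inner product $\langle a,b\rangle_{\mathbb{C}}$ is the orthogonal projection of $ab^*$ onto $\mathbb{C}_n$; $a,b$ are $\mathbb{C}$-orthogonal if $\langle a,b\rangle_{\mathbb{C}}=0$. $\mathbb{C}_n^\perp$ is the orthogonal complement of $\mathbb{C}_n$ in $A_n$. $\mathbb{H}_{n+1}$ is the $\mathbb{R}$-linear span in $A_{n+1}$ of $(1,0),(0,1),(i_n,0),(0,i_n)$, and $\mathbb{H}_{n+1}^\perp=\mathbb{C}_n^\perp\times\mathbb{C}_n^\perp$ its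 orthogonal complement in $A_{n+1}$. For $a,b\in\mathbb{C}_n^\perp$, $\{a,b\}$ denotes the element $\frac{1}{\sqrt2}\big(a+b,\;i_n(-a+b)\big)$ of $A_{n+1}$. For $x\in A_m$, $\mathrm{Ann}(x)=\{y\in A_m: xy=0\}$; dimensions are over $\mathbb{R}$. The $D$-locus in $A_{n+1}$ is the space of all elements $\{a,b\}$ with $a,b\in\mathbb{C}_n^\perp$ such that (1) $a$ and $b$ are $\mathbb{C}$-orthogonal, (2) $a$ is orthogonal to $\mathrm{Ann}(b)$, and (3) $b$ is orthogonal to $\mathrm{Ann}(a)$ (annihilators taken in $A_n$). *)

theory Defs
  imports "HOL-Analysis.Analysis" "HOL-Analysis.Finite_Function_Topology"
begin

text \<open>All the algebras \<open>A\<^sub>n\<close> live inside the real vector space of finitely supported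
  functions \<open>nat \<Rightarrow>\<^sub>0 real\<close>: \<open>A\<^sub>n\<close> consists of the functions supported
  on the indices below \<open>2 ^ n\<close>.  A pair \<open>(a, b)\<close> of elements of \<open>A\<^sub>n\<close> is
  stored as the element of \<open>A\<^sub>n\<^sub>+\<^sub>1\<close> with \<open>a\<close> on the indices below \<open>2 ^ n\<close> and \<open>b\<close> on
  the next \<open>2 ^ n\<close> indices.  Addition, scalars, \<open>span\<close> and \<open>dim\<close> are those of the
  ambient vector space; its ring multiplication (convolution) and its (L1) norm are
  not used.\<close>

type_synonym cd = "nat \<Rightarrow>\<^sub>0 real"

definition cd_carrier :: "nat \<Rightarrow> cd set" where
  "cd_carrier n = {x. Poly_Mapping.keys x \<subseteq> {..<2 ^ n}}"

definition cd_pair :: "nat \<Rightarrow> cd \<Rightarrow> cd \<Rightarrow> cd" where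
  "cd_pair n a b = (\<Sum>i<2 ^ n. Poly_Mapping.single i (Poly_Mapping.lookup a i))
                 + (\<Sum>i<2 ^ n. Poly_Mapping.single (2 ^ n + i) (Poly_Mapping.lookup b i))"

definition cd_fst :: "nat \<Rightarrow> cd \<Rightarrow> cd" where
  "cd_fst n x = (\<Sum>i<2 ^ n. Poly_Mapping.single i (Poly_Mapping.lookup x i))"

definition cd_snd :: "nat \<Rightarrow> cd \<Rightarrow> cd" where
  "cd_snd n x = (\<Sum>i<2 ^ n. Poly_Mapping.single i (Poly_Mapping.lookup x (2 ^ n + i)))"

lemma lookup_cd_pair:
  "Poly_Mapping.lookup (cd_pair n a b) k =
    (if k < 2 ^ n then Poly_Mapping.lookup a k
     else if k < 2 ^ n + 2 ^ n then Poly_Mapping.lookup b (k - 2 ^ n) else 0)"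
proof -
  have 1: "(\<Sum>i<2 ^ n. Poly_Mapping.lookup (Poly_Mapping.single i (Poly_Mapping.lookup a i)) k)
      = (if k < 2 ^ n then Poly_Mapping.lookup a k else 0)"
    by (simp add: lookup_single when_def)
  have 2: "(\<Sum>i<2 ^ n. Poly_Mapping.lookup (Poly_Mapping.single (2 ^ n + i) (Poly_Mapping.lookup b i)) k)
      = (if 2 ^ n \<le> k \<and> k < 2 ^ n + 2 ^ n then Poly_Mapping.lookup b (k - 2 ^ n) else 0)"
  proof -
    have "(\<Sum>i<2 ^ n. Poly_Mapping.lookup (Poly_Mapping.single (2 ^ n + i) (Poly_Mapping.lookup b i)) k)
      = (\<Sum>i<2 ^ n. if i = k - 2 ^ n then (if 2 ^ n \<le> k then Poly_Mapping.lookup b i else 0) else 0)"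
      by (intro sum.cong) (auto simp: lookup_single when_def)
    also have "\<dots> = (if 2 ^ n \<le> k \<and> k < 2 ^ n + 2 ^ n then Poly_Mapping.lookup b (k - 2 ^ n) else 0)"
      by (auto simp: sum.delta)
    finally show ?thesis .
  qed
  show ?thesis
    unfolding cd_pair_def lookup_add lookup_sum 1 2 by auto
qed

lemma lookup_cd_fst:
  "Poly_Mapping.lookup (cd_fst n x) k = (if k < 2 ^ n then Poly_Mapping.lookup x k else 0)"
  unfolding cd_fst_def lookup_sum by (simp add: lookup_single when_def)

lemma lookup_cd_snd:
  "Poly_Mapping.lookup (cd_snd n x) k = (if k < 2 ^ n then Poly_Mapping.lookup x (2 ^ n + k) else 0)"
  unfolding cd_snd_def lookup_sum by (simp add: lookup_single when_def)

lemma cd_carrier_iff: "x \<in> cd_carrier n \<longleftrightarrow> (\<forall>k\<ge>2 ^ n. Poly_Mapping.lookup x k = 0)"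
  unfolding cd_carrier_def by (auto simp: in_keys_iff subset_iff not_less[symmetric])

lemma cd_pair_carrier: "cd_pair n a b \<in> cd_carrier (Suc n)"
  by (auto simp: cd_carrier_iff lookup_cd_pair)

lemma cd_fst_pair: "a \<in> cd_carrier n \<Longrightarrow> cd_fst n (cd_pair n a b) = a"
  by (intro poly_mapping_eqI) (auto simp: lookup_cd_fst lookup_cd_pair cd_carrier_iff)

lemma cd_snd_pair: "b \<in> cd_carrier n \<Longrightarrow> cd_snd n (cd_pair n a b) = b"
  by (intro poly_mapping_eqI) (auto simp: lookup_cd_snd lookup_cd_pair cd_carrier_iff)

lemma cd_pair_fst_snd: "x \<in> cd_carrier (Suc n) \<Longrightarrow> cd_pair n (cd_fst n x) (cd_snd n x) = x"
  by (intro poly_mapping_eqI)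
     (auto simp: lookup_cd_fst lookup_cd_snd lookup_cd_pair cd_carrier_iff)

primrec cd_conj :: "nat \<Rightarrow> cd \<Rightarrow> cd" where
  "cd_conj 0 x = x"
| "cd_conj (Suc n) x = cd_pair n (cd_conj n (cd_fst n x)) (- cd_snd n x)"

primrec cd_mult :: "nat \<Rightarrow> cd \<Rightarrow> cd \<Rightarrow> cd" where
  "cd_mult 0 x y = Poly_Mapping.single 0 (Poly_Mapping.lookup x 0 * Poly_Mapping.lookup y 0)"
| "cd_mult (Suc n) x y =
    (let a = cd_fst n x; b = cd_snd n x; c = cd_fst n y; d = cd_snd n y
     in cd_pair n (cd_mult n a c - cd_mult n (cd_conj n d) b)
                  (cd_mult n d a + cd_mult n b (cd_conj n c)))"

lemma cd_conj_pair:
  assumes "a \<in> cd_carrier n" "b \<in> cd_carrier n"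
  shows "cd_conj (Suc n) (cd_pair n a b) = cd_pair n (cd_conj n a) (- b)"
  using assms by (simp add: cd_fst_pair cd_snd_pair)

lemma cd_mult_pair:
  assumes "a \<in> cd_carrier n" "b \<in> cd_carrier n" "c \<in> cd_carrier n" "d \<in> cd_carrier n"
  shows "cd_mult (Suc n) (cd_pair n a b) (cd_pair n c d) =
    cd_pair n (cd_mult n a c - cd_mult n (cd_conj n d) b)
              (cd_mult n d a + cd_mult n b (cd_conj n c))"
  using assms by (simp add: cd_fst_pair cd_snd_pair)

text \<open>The unit is the same element of the ambient space for every \<open>n\<close>, since
  \<open>cd_pair n a 0 = a\<close> for \<open>a\<close> in \<open>A\<^sub>n\<close>.\<close>

definition cd_one :: cd where
  "cd_one = Poly_Mapping.single 0 1"

text \<open>\<open>i\<^sub>n = (0, 1)\<close>, meaningful for \<open>n \<ge> 1\<close> only.\<close>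

definition cd_i :: "nat \<Rightarrow> cd" where
  "cd_i n = cd_pair (n - 1) 0 cd_one"

definition cd_Re :: "nat \<Rightarrow> cd \<Rightarrow> cd" where
  "cd_Re n x = (1 / 2) *\<^sub>R (x + cd_conj n x)"

text \<open>\<open>Re (a b\<^sup>*)\<close> is a real multiple of \<open>cd_one\<close>; the inner product is the real
  coefficient.\<close>

definition cd_inner :: "nat \<Rightarrow> cd \<Rightarrow> cd \<Rightarrow> real" where
  "cd_inner n a b = Poly_Mapping.lookup (cd_Re n (cd_mult n a (cd_conj n b))) 0"

definition cd_perp :: "nat \<Rightarrow> cd set \<Rightarrow> cd set" where
  "cd_perp n S = {x \<in> cd_carrier n. \<forall>y\<in>S. cd_inner n x y = 0}"

definition cd_C :: "nat \<Rightarrow> cd set" where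
  "cd_C n = span {cd_one, cd_i n}"

definition cd_proj_C :: "nat \<Rightarrow> cd \<Rightarrow> cd" where
  "cd_proj_C n x = (THE c. c \<in> cd_C n \<and> x - c \<in> cd_perp n (cd_C n))"

definition cd_hermitian :: "nat \<Rightarrow> cd \<Rightarrow> cd \<Rightarrow> cd" where
  "cd_hermitian n a b = cd_proj_C n (cd_mult n a (cd_conj n b))"

text \<open>\<open>cd_H_Suc n\<close> is the subspace \<open>H\<^sub>n\<^sub>+\<^sub>1\<close> of \<open>A\<^sub>n\<^sub>+\<^sub>1\<close>.\<close>

definition cd_H_Suc :: "nat \<Rightarrow> cd set" where
  "cd_H_Suc n = span {cd_pair n cd_one 0, cd_pair n 0 cd_one,
                      cd_pair n (cd_i n) 0, cd_pair n 0 (cd_i n)}"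

text \<open>\<open>cd_brace n a b\<close> is the element \<open>{a, b}\<close> of \<open>A\<^sub>n\<^sub>+\<^sub>1\<close>.\<close>

definition cd_brace :: "nat \<Rightarrow> cd \<Rightarrow> cd \<Rightarrow> cd" where
  "cd_brace n a b = (1 / sqrt 2) *\<^sub>R cd_pair n (a + b) (cd_mult n (cd_i n) (- a + b))"

definition cd_Ann :: "nat \<Rightarrow> cd \<Rightarrow> cd set" where
  "cd_Ann m x = {y \<in> cd_carrier m. cd_mult m x y = 0}"

text \<open>\<open>D_locus n\<close> is the \<open>D\<close>-locus in \<open>A\<^sub>n\<^sub>+\<^sub>1\<close>.\<close>

definition D_locus :: "nat \<Rightarrow> cd set" where
  "D_locus n = {cd_brace n a b | a b.
      a \<in> cd_perp n (cd_C n) \<and> b \<in> cd_perp n (cd_C n) \<and>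
      cd_hermitian n a b = 0 \<and>
      (\<forall>y\<in>cd_Ann n b. cd_inner n a y = 0) \<and>
      (\<forall>y\<in>cd_Ann n a. cd_inner n b y = 0)}"

end

theory Submission
  imports Defs
begin

text \<open>Left multiplication by \<open>i\<^sub>n\<close> makes \<open>C\<^sub>n\<^sup>\<bottom>\<close> a complex vector space.  For \<open>x, y \<in> C\<^sub>n\<^sup>\<bottom>\<close> write
  \<open>P(xy)\<close> and \<open>Q(xy)\<close> for the components of \<open>xy\<close> in \<open>C\<^sub>n\<close> and \<open>C\<^sub>n\<^sup>\<bottom>\<close>: the first is
  sesquilinear, and the second is conjugate-linear in both variables and antisymmetric.  An element of
  \<open>A\<^sub>n\<^sub>+\<^sub>1\<close> has the form \<open>h + {x, y}\<close> with \<open>h \<in> H\<^sub>n\<^sub>+\<^sub>1\<close>, and \<open>{a, b}(h + {x, y}) = 0\<close> means that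
  \<open>Q(ax)\<close> and \<open>Q(by)\<close> are certain complex combinations of \<open>a\<close> and \<open>b\<close> with coefficients read off
  from \<open>h\<close>, that \<open>P(by)\<close> is minus the conjugate of \<open>P(ax)\<close>, and that \<open>P(bx)\<close> is the conjugate of
  \<open>P(ay)\<close>.

  By adjointness \<open>Q(ax)\<close> is orthogonal to \<open>a\<close>, \<open>i\<^sub>n a\<close> and \<open>Ann(a)\<close>, and likewise for \<open>b\<close>; if one
  of the conditions defining the \<open>D\<close>-locus fails, this forces \<open>h = 0\<close>.  The pairs \<open>(x, y)\<close> with
  \<open>Q(ax) = Q(by) = 0\<close> and \<open>P(by)\<close> minus the conjugate of \<open>P(ax)\<close> form a space \<open>K\<close> on which
  \<open>(x, y) \<mapsto> P(ax)\<close> is onto the complex numbers with kernel \<open>Ann(a) \<times> Ann(b)\<close>.  The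
  remaining condition is the vanishing of another map from \<open>K\<close> to the complex numbers, which is onto unless
  all conditions of the \<open>D\<close>-locus hold; hence its kernel has the same dimension.\<close>

section \<open>Dimensions in infinite-dimensional real vector spaces\<close>

text \<open>Rank-nullity inside a possibly infinite-dimensional type, where the finite set
  \<open>E\<close> supplies finiteness. A basis \<open>B0\<close> of the kernel is extended to a
  basis \<open>B\<close> of \<open>S\<close>; \<open>f\<close> is injective on the span of
  \<open>B - B0\<close> and maps it onto the image.\<close>

lemma dim_kernel_image:
  fixes f :: "'a::real_vector \<Rightarrow> 'b::real_vector"
  assumes f: "linear f" and S: "subspace S" and fin: "S \<subseteq> span E" "finite E"
  shows "dim S = dim {x \<in> S. f x = 0} + dim (f ` S)"
proof -
  interpret f: linear f by fact
  let ?K = "{x \<in> S. f x = 0}"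
  have K: "subspace ?K"
    using S by (auto simp: subspace_def f.add f.scaleR)
  obtain B0 where B0: "B0 \<subseteq> ?K" "independent B0" "?K \<subseteq> span B0"
    by (rule basis_exists[of ?K])
  obtain B where B: "B0 \<subseteq> B" "B \<subseteq> S" "independent B" "S \<subseteq> span B"
    using maximal_independent_subset_extend[of B0 S] B0 by (metis (no_types, lifting) mem_Collect_eq subset_iff)
  have fB: "finite B"
    using independent_span_bound[OF fin(2) B(3)] B(2) fin(1) by blast
  define C where "C = B - B0"
  have spB: "span B = S" and spB0: "span B0 = ?K"
    using span_subspace[OF B(2,4) S] span_subspace[OF B0(1,3) K] by auto
  have "inj_on f (span C)"
  proof (subst linear_injective_on_subspace_0[OF f subspace_span], intro ballI impI)
    fix x assume x: "x \<in> span C" "f x = 0"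
    have "span C \<subseteq> S"
      unfolding C_def spB[symmetric] by (intro span_mono) auto
    then have x0: "x \<in> span B0"
      using x spB0 by auto
    \<comment> \<open>As \<open>x\<close> lies in the span of \<open>C\<close> and of
      \<open>B0\<close>, its coordinates vanish outside each of these two disjoint parts of
      \<open>B\<close>.\<close>
    have "representation B x v = 0" for v
    proof (cases "v \<in> B0")
      case True
      then show ?thesis
        using representation_extend[OF B(3) x(1)] representation_ne_zero[of C x v]
        by (auto simp: C_def)
    next
      case False
      then show ?thesis
        using representation_extend[OF B(3) x0 B(1)] representation_ne_zero[of B0 x v] by auto
    qed
    then show "x = 0"
      using sum_nonzero_representation_eq[OF B(3), of x] x0 span_mono[OF B(1)] by (simp add: subsetD)
  qed
  moreover have "independent C"
    using B(3) independent_mono unfolding C_def by blast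
  ultimately have "independent (f ` C)" "card (f ` C) = card C"
    using linear_independent_injective_image[OF f] inj_on_subset[OF _ span_superset]
    by (auto intro: card_image)
  moreover have "f ` S = span (f ` C)"
  proof -
    have "f ` B \<subseteq> span (f ` C)"
      using B0(1) unfolding C_def by (fastforce intro: span_base span_zero)
    then have "span (f ` B) = span (f ` C)"
      by (intro antisym span_minimal span_mono subspace_span) (auto simp: C_def)
    then show ?thesis
      by (simp add: linear_span_image[OF f, symmetric] spB[symmetric])
  qed
  ultimately have "dim (f ` S) = card C"
    by (simp add: dim_eq_card_independent)
  moreover have "dim S = card B" "dim ?K = card B0"
    using B B0 by (auto intro!: basis_card_eq_dim[symmetric])
  ultimately show ?thesis
    using card_Diff_subset[of B0 B] card_mono[OF fB B(1)] finite_subset[OF B(1) fB] B(1)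
    by (simp add: C_def)
qed

lemma Times_subset_span:
  fixes S :: "'a::real_vector set" and T :: "'b::real_vector set"
  assumes "S \<subseteq> span E" "T \<subseteq> span E'"
  shows "S \<times> T \<subseteq> span (E \<times> {0} \<union> {0} \<times> E')"
proof
  fix p assume p: "p \<in> S \<times> T"
  have "(fst p, 0) \<in> span (E \<times> {0})"
    unfolding span_Times_sing2 using assms p by auto
  moreover have "(0, snd p) \<in> span ({0} \<times> E')"
    unfolding span_Times_sing1 using assms p by auto
  ultimately have "(fst p, 0) + (0, snd p) \<in> span (E \<times> {0} \<union> {0} \<times> E')"
    by (intro span_add) (auto intro: subsetD[OF span_mono, rotated])
  then show "p \<in> span (E \<times> {0} \<union> {0} \<times> E')"
    by simp
qed

text \<open>Rank-nullity twice: for \<open>fst\<close> on the product, then for \<open>snd\<close>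
  on its kernel \<open>{0} \<times> T\<close>.\<close>

lemma dim_Times:
  fixes S :: "'a::real_vector set" and T :: "'b::real_vector set"
  assumes S: "subspace S" "S \<subseteq> span E" "finite E" and T: "subspace T" "T \<subseteq> span E'" "finite E'"
  shows "dim (S \<times> T) = dim S + dim T"
proof -
  let ?E = "E \<times> {0} \<union> {0} \<times> E'"
  have fin: "finite ?E"
    using S T by simp
  have sub: "S \<times> T \<subseteq> span ?E"
    using S T by (intro Times_subset_span)
  have 0: "0 \<in> S" "0 \<in> T"
    using S T by (auto intro: subspace_0)
  have sub0: "subspace ({0::'a} \<times> T)"
    using T(1) by (intro subspace_Times) (simp_all add: subspace_def)
  have "dim (S \<times> T) = dim {p \<in> S \<times> T. fst p = 0} + dim (fst ` (S \<times> T))"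
    by (rule dim_kernel_image[OF linear_fst subspace_Times[OF S(1) T(1)] sub fin])
  also have "{p \<in> S \<times> T. fst p = 0} = {0} \<times> T"
    using 0 by auto
  also have "fst ` (S \<times> T) = S"
    using 0 by force
  also have "dim ({0::'a} \<times> T) = dim {p \<in> {0::'a} \<times> T. snd p = 0} + dim (snd ` ({0::'a} \<times> T))"
    by (rule dim_kernel_image[OF linear_snd sub0 _ fin]) (use sub 0 in blast)
  also have "{p \<in> {0::'a} \<times> T. snd p = 0} = {0}"
    using 0 by (auto simp: zero_prod_def)
  also have "dim {0::'a \<times> 'b} = 0"
    by (rule dim_unique[of "{}"]) (auto simp: independent_empty)
  also have "snd ` ({0::'a} \<times> T) = T"
    by force
  finally show ?thesis by simp
qed

lemma dim_inj_on_image: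
  fixes f :: "'a::real_vector \<Rightarrow> 'b::real_vector"
  assumes f: "linear f" and S: "subspace S" and fin: "S \<subseteq> span E" "finite E"
    and inj: "\<And>x. x \<in> S \<Longrightarrow> f x = 0 \<Longrightarrow> x = 0"
  shows "dim (f ` S) = dim S"
proof -
  have "{x \<in> S. f x = 0} = {0}"
    using inj subspace_0[OF S] linear_0[OF f] by blast
  moreover have "dim {0::'a} = 0"
    by (rule dim_unique[of "{}"]) (auto simp: independent_empty)
  ultimately show ?thesis
    using dim_kernel_image[OF f S fin] by simp
qed

section \<open>The involutive algebras \<open>A\<^sub>n\<close>\<close>

abbreviation "lkp \<equiv> Poly_Mapping.lookup"

lemma lookup_scaleR [simp]: "lkp (r *\<^sub>R x) k = r * lkp x k"
proof -
  have "finite {i. r * lkp x i \<noteq> 0}"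
    by (rule finite_subset[OF _ finite_lookup[of x]]) auto
  then show ?thesis
    by (simp add: scaleR_poly_mapping_def)
qed

lemma linear_cd_fst: "linear (cd_fst n)"
  by (auto intro!: linearI poly_mapping_eqI simp: lookup_cd_fst lookup_add)

lemma linear_cd_snd: "linear (cd_snd n)"
  by (auto intro!: linearI poly_mapping_eqI simp: lookup_cd_snd lookup_add)

lemmas cd_fst_linear_simps [simp] =
  linear_add[OF linear_cd_fst] linear_diff[OF linear_cd_fst] linear_neg[OF linear_cd_fst]
  linear_scale[OF linear_cd_fst] linear_0[OF linear_cd_fst]

lemmas cd_snd_linear_simps [simp] =
  linear_add[OF linear_cd_snd] linear_diff[OF linear_cd_snd] linear_neg[OF linear_cd_snd]
  linear_scale[OF linear_cd_snd] linear_0[OF linear_cd_snd]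

lemma cd_pair_add: "cd_pair n (a + c) (b + d) = cd_pair n a b + cd_pair n c d"
  and cd_pair_uminus: "cd_pair n (- a) (- b) = - cd_pair n a b"
  and cd_pair_scaleR: "cd_pair n (r *\<^sub>R a) (r *\<^sub>R b) = r *\<^sub>R cd_pair n a b"
  and cd_pair_zero [simp]: "cd_pair n 0 0 = 0"
  by (auto intro!: poly_mapping_eqI simp: lookup_cd_pair lookup_add lookup_minus)

lemma subspace_cd_carrier: "subspace (cd_carrier n)"
  by (auto simp: subspace_def cd_carrier_iff lookup_add)

lemmas cd_carrier_closed [simp, intro] =
  subspace_add[OF subspace_cd_carrier] subspace_diff[OF subspace_cd_carrier]
  subspace_neg[OF subspace_cd_carrier] subspace_scale[OF subspace_cd_carrier]
  subspace_0[OF subspace_cd_carrier]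

lemma cd_carrier_0_eqI:
  assumes "x \<in> cd_carrier 0" "y \<in> cd_carrier 0" "lkp x 0 = lkp y 0"
  shows "x = y"
proof (rule poly_mapping_eqI)
  fix k show "lkp x k = lkp y k"
    using assms unfolding cd_carrier_iff by (cases "k = 0") auto
qed

lemma lookup_cd_one: "lkp cd_one k = (if k = 0 then 1 else 0)"
  by (simp add: cd_one_def lookup_one when_def)

lemma cd_one_carrier [simp, intro]: "cd_one \<in> cd_carrier n"
  by (auto simp: cd_carrier_iff lookup_cd_one)

lemma cd_fst_carrier [simp, intro]: "cd_fst n x \<in> cd_carrier n"
  and cd_snd_carrier [simp, intro]: "cd_snd n x \<in> cd_carrier n"
  by (auto simp: cd_carrier_iff lookup_cd_fst lookup_cd_snd)

declare cd_pair_carrier [simp, intro]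

lemma cd_carrier_pair_cases:
  assumes "x \<in> cd_carrier (Suc n)"
  obtains a b where "a \<in> cd_carrier n" "b \<in> cd_carrier n" "x = cd_pair n a b"
  using cd_pair_fst_snd[OF assms] by (metis cd_fst_carrier cd_snd_carrier)

lemma cd_pair_eq_iff:
  assumes "a \<in> cd_carrier n" "b \<in> cd_carrier n" "c \<in> cd_carrier n" "d \<in> cd_carrier n"
  shows "cd_pair n a b = cd_pair n c d \<longleftrightarrow> a = c \<and> b = d"
  by (metis assms cd_fst_pair cd_snd_pair)

lemma linear_cd_conj: "linear (cd_conj n)"
proof (induction n)
  case 0
  show ?case by (auto intro: linearI)
next
  case (Suc n)
  show ?case
    by (rule linearI) (auto simp: linear_add[OF Suc] linear_scale[OF Suc]
        simp flip: cd_pair_add cd_pair_scaleR)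
qed

lemmas cd_conj_linear_simps [simp] =
  linear_add[OF linear_cd_conj] linear_diff[OF linear_cd_conj] linear_neg[OF linear_cd_conj]
  linear_scale[OF linear_cd_conj] linear_0[OF linear_cd_conj]

lemma cd_conj_carrier [simp, intro]: "x \<in> cd_carrier n \<Longrightarrow> cd_conj n x \<in> cd_carrier n"
  by (cases n) auto

text \<open>Each doubling step negates the second half, so only the coordinate at index 0 keeps its
  sign.\<close>

lemma cd_conj_eq:
  "x \<in> cd_carrier n \<Longrightarrow> cd_conj n x = (2 * lkp x 0) *\<^sub>R cd_one - x"
proof (induction n arbitrary: x)
  case 0
  then show ?case
    by (intro cd_carrier_0_eqI) (auto simp: lookup_minus lookup_cd_one)
next
  case (Suc n)
  obtain a b where *: "x = cd_pair n a b" "a \<in> cd_carrier n" "b \<in> cd_carrier n"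
    using Suc.prems by (rule cd_carrier_pair_cases)
  show ?case
  proof (rule poly_mapping_eqI)
    fix k
    show "lkp (cd_conj (Suc n) x) k = lkp ((2 * lkp x 0) *\<^sub>R cd_one - x) k"
      using * by (simp add: cd_conj_pair Suc.IH lookup_cd_pair lookup_minus lookup_cd_one
          del: cd_conj.simps)
  qed
qed

lemma cd_conj_conj [simp]: "x \<in> cd_carrier n \<Longrightarrow> cd_conj n (cd_conj n x) = x"
proof (induction n arbitrary: x)
  case (Suc n)
  then show ?case
    by (auto elim!: cd_carrier_pair_cases simp: cd_fst_pair cd_snd_pair)
qed auto

lemma bilinear_cd_mult: "bilinear (cd_mult n)"
proof (induction n)
  case 0
  show ?case
    by (auto simp: bilinear_def intro!: linearI poly_mapping_eqI
        simp: lookup_single lookup_add when_def algebra_simps)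
next
  case (Suc n)
  note b = bilinear_ladd[OF Suc] bilinear_radd[OF Suc] bilinear_lmul[OF Suc] bilinear_rmul[OF Suc]
  show ?case
    unfolding bilinear_def
    by (auto intro!: linearI simp: b Let_def scaleR_add_right scaleR_diff_right
        simp flip: cd_pair_add cd_pair_scaleR) (simp_all add: algebra_simps)
qed

lemmas cd_mult_bilinear_simps [simp] =
  bilinear_ladd[OF bilinear_cd_mult] bilinear_radd[OF bilinear_cd_mult]
  bilinear_lsub[OF bilinear_cd_mult] bilinear_rsub[OF bilinear_cd_mult]
  bilinear_lneg[OF bilinear_cd_mult] bilinear_rneg[OF bilinear_cd_mult]
  bilinear_lmul[OF bilinear_cd_mult] bilinear_rmul[OF bilinear_cd_mult]
  bilinear_lzero[OF bilinear_cd_mult] bilinear_rzero[OF bilinear_cd_mult]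

lemma cd_mult_carrier [simp, intro]: "cd_mult n x y \<in> cd_carrier n"
proof (cases n)
  case 0
  then show ?thesis
    by (auto simp: cd_carrier_iff lookup_single when_def)
qed (simp add: Let_def)

lemma cd_one_pair: "cd_one = cd_pair n cd_one 0"
  by (auto intro!: poly_mapping_eqI simp: lookup_cd_one lookup_cd_pair)

lemma cd_mult_one [simp]:
  assumes "x \<in> cd_carrier n"
  shows "cd_mult n x cd_one = x" "cd_mult n cd_one x = x"
proof -
  have "cd_mult n x cd_one = x \<and> cd_mult n cd_one x = x"
    using assms
  proof (induction n arbitrary: x)
    case 0
    then show ?case
      by (auto intro!: cd_carrier_0_eqI simp: lookup_cd_one cd_carrier_iff lookup_single when_def)
  next
    case (Suc n)
    have *: "cd_conj n cd_one = cd_one"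
      by (simp add: cd_conj_eq lookup_cd_one scaleR_2)
    show ?case
    proof -
      obtain a b where "x = cd_pair n a b" "a \<in> cd_carrier n" "b \<in> cd_carrier n"
        using Suc.prems by (rule cd_carrier_pair_cases)
      then show ?thesis
        using cd_mult_pair[of a n b cd_one 0] cd_mult_pair[of cd_one n 0 a b]
        unfolding cd_one_pair[of n, symmetric] by (simp add: Suc.IH * del: cd_mult.simps)
    qed
  qed
  then show "cd_mult n x cd_one = x" "cd_mult n cd_one x = x" by auto
qed

lemma cd_conj_mult:
  assumes "x \<in> cd_carrier n" "y \<in> cd_carrier n"
  shows "cd_conj n (cd_mult n x y) = cd_mult n (cd_conj n y) (cd_conj n x)"
  using assms
proof (induction n arbitrary: x y)
  case 0
  then show ?case by (simp add: mult.commute)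
next
  case (Suc n)
  obtain a b c d where *: "x = cd_pair n a b" "y = cd_pair n c d" 
    "a \<in> cd_carrier n" "b \<in> cd_carrier n" "c \<in> cd_carrier n" "d \<in> cd_carrier n"
    using Suc.prems by (metis cd_carrier_pair_cases)
  then show ?case
    by (simp add: cd_mult_pair cd_conj_pair Suc.IH algebra_simps del: cd_mult.simps cd_conj.simps)
qed

section \<open>The inner product in coordinates, and adjoints of multiplications\<close>

definition cd_dot :: "nat \<Rightarrow> cd \<Rightarrow> cd \<Rightarrow> real" where
  "cd_dot n x y = (\<Sum>k<2 ^ n. lkp x k * lkp y k)"

lemma cd_dot_commute: "cd_dot n x y = cd_dot n y x"
  by (simp add: cd_dot_def mult.commute)

lemma bilinear_cd_dot: "bilinear (cd_dot n)"
  by (auto simp: bilinear_def cd_dot_def lookup_add algebra_simps sum.distrib sum_distrib_left intro!: linearI)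

lemmas cd_dot_bilinear_simps [simp] =
  bilinear_ladd[OF bilinear_cd_dot] bilinear_radd[OF bilinear_cd_dot]
  bilinear_lsub[OF bilinear_cd_dot] bilinear_rsub[OF bilinear_cd_dot]
  bilinear_lneg[OF bilinear_cd_dot] bilinear_rneg[OF bilinear_cd_dot]
  bilinear_lmul[OF bilinear_cd_dot] bilinear_rmul[OF bilinear_cd_dot]
  bilinear_lzero[OF bilinear_cd_dot] bilinear_rzero[OF bilinear_cd_dot]

lemma cd_dot_pair:
  "cd_dot (Suc n) (cd_pair n a b) (cd_pair n c d) = cd_dot n a c + cd_dot n b d"
proof -
  have "cd_dot (Suc n) (cd_pair n a b) (cd_pair n c d) =
    (\<Sum>k<2 ^ n + 2 ^ n. lkp (cd_pair n a b) k * lkp (cd_pair n c d) k)"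
    by (simp add: cd_dot_def mult_2)
  also have "\<dots> = (\<Sum>k<2 ^ n. lkp (cd_pair n a b) k * lkp (cd_pair n c d) k) +
     (\<Sum>k<2 ^ n. lkp (cd_pair n a b) (2 ^ n + k) * lkp (cd_pair n c d) (2 ^ n + k))"
    using sum.atLeastLessThan_concat[of 0 "2 ^ n" "2 ^ n + 2 ^ n"
        "\<lambda>k. lkp (cd_pair n a b) k * lkp (cd_pair n c d) k"]
      sum.shift_bounds_nat_ivl[of "\<lambda>k. lkp (cd_pair n a b) k * lkp (cd_pair n c d) k" 0 "2 ^ n" "2 ^ n"]
    by (simp add: atLeast0LessThan add.commute)
  also have "\<dots> = cd_dot n a c + cd_dot n b d"
    by (simp add: cd_dot_def lookup_cd_pair)
  finally show ?thesis .
qed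

lemma cd_dot_self_eq_0:
  assumes "x \<in> cd_carrier n" 
  shows "cd_dot n x x = 0 \<longleftrightarrow> x = 0"
proof
  assume "cd_dot n x x = 0"
  then have "\<forall>k<2 ^ n. lkp x k = 0"
    by (simp add: cd_dot_def sum_nonneg_eq_0_iff)
  then show "x = 0"
    using assms by (intro poly_mapping_eqI) (metis cd_carrier_iff lookup_zero not_le)
qed auto

lemma cd_dot_self_nonneg: "cd_dot n x x \<ge> 0"
  by (auto simp: cd_dot_def intro: sum_nonneg)

lemma lookup_cd_conj_0: "x \<in> cd_carrier n \<Longrightarrow> lkp (cd_conj n x) 0 = lkp x 0"
  by (simp add: cd_conj_eq lookup_minus lookup_cd_one)

lemma cd_dot_one: "cd_dot n x cd_one = lkp x 0"
proof -
  have "cd_dot n x cd_one = (\<Sum>k<2 ^ n. if k = (0::nat) then lkp x 0 else 0)"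
    unfolding cd_dot_def by (intro sum.cong) (auto simp: lookup_cd_one)
  then show ?thesis by simp
qed

lemma cd_dot_conj:
  assumes "x \<in> cd_carrier n" "y \<in> cd_carrier n"
  shows "cd_dot n (cd_conj n x) (cd_conj n y) = cd_dot n x y"
  using assms by (simp add: cd_conj_eq cd_dot_one cd_dot_commute[of n cd_one] algebra_simps lookup_cd_one lookup_minus)

lemma cd_dot_mult_left:
  assumes "a \<in> cd_carrier n" "x \<in> cd_carrier n" "y \<in> cd_carrier n"
  shows "cd_dot n (cd_mult n a x) y = cd_dot n x (cd_mult n (cd_conj n a) y)"
  using assms
proof (induction n arbitrary: a x y)
  case 0
  then show ?case by (simp add: cd_dot_def)
next
  case (Suc n)
  \<comment> \<open>Right multiplications reduce to the induction hypothesis, because conjugation is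
    an isometry that reverses products.\<close>
  have R: "cd_dot n (cd_mult n x a) y = cd_dot n x (cd_mult n y (cd_conj n a))"
    if "a \<in> cd_carrier n" "x \<in> cd_carrier n" "y \<in> cd_carrier n" for a x y
  proof -
    have "cd_dot n (cd_mult n x a) y = cd_dot n (cd_mult n (cd_conj n a) (cd_conj n x)) (cd_conj n y)"
      using that by (metis cd_conj_mult cd_dot_conj cd_mult_carrier)
    also have "\<dots> = cd_dot n (cd_conj n x) (cd_mult n a (cd_conj n y))"
      using that by (simp add: Suc.IH)
    also have "cd_mult n a (cd_conj n y) = cd_conj n (cd_mult n y (cd_conj n a))"
      using that by (simp add: cd_conj_mult)
    finally show ?thesis
      using that by (simp add: cd_dot_conj)
  qed
  obtain p q r s e f where *: "a = cd_pair n p q" "x = cd_pair n r s" "y = cd_pair n e f"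
    "p \<in> cd_carrier n" "q \<in> cd_carrier n" "r \<in> cd_carrier n" "s \<in> cd_carrier n"
    "e \<in> cd_carrier n" "f \<in> cd_carrier n"
    by (metis Suc.prems cd_pair_fst_snd cd_fst_carrier cd_snd_carrier)
  have 1: "cd_dot n (cd_mult n (cd_conj n s) q) e = cd_dot n s (cd_mult n q (cd_conj n e))"
  proof -
    have "cd_dot n (cd_mult n (cd_conj n s) q) e = cd_dot n (cd_conj n s) (cd_conj n (cd_mult n q (cd_conj n e)))"
      using * by (simp add: R cd_conj_mult)
    then show ?thesis using * by (simp add: cd_dot_conj)
  qed
  have 2: "cd_dot n (cd_mult n q (cd_conj n r)) f = cd_dot n r (cd_mult n (cd_conj n f) q)"
  proof -
    have "cd_dot n (cd_mult n q (cd_conj n r)) f = cd_dot n (cd_conj n r) (cd_conj n (cd_mult n (cd_conj n f) q))"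
      using * by (simp add: Suc.IH cd_conj_mult)
    then show ?thesis using * by (simp add: cd_dot_conj)
  qed
  show ?case
    using * by (simp add: cd_mult_pair cd_conj_pair cd_dot_pair 1 2 R[of p s f] Suc.IH[of p r e] del: cd_mult.simps cd_conj.simps)
qed

text \<open>The real part of \<open>x y*\<close> is its dot product with \<open>cd_one\<close>;
  moving \<open>x\<close> across by adjointness leaves the dot product of the conjugates.\<close>

lemma cd_inner_eq_dot:
  assumes "x \<in> cd_carrier n" "y \<in> cd_carrier n"
  shows "cd_inner n x y = cd_dot n x y"
proof -
  have "cd_inner n x y = cd_dot n (cd_mult n x (cd_conj n y)) cd_one"
    by (simp add: cd_inner_def cd_Re_def lookup_cd_conj_0 lookup_add cd_dot_one)
  also have "\<dots> = cd_dot n (cd_conj n y) (cd_conj n x)"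
    using assms by (simp add: cd_dot_mult_left)
  finally show ?thesis
    using assms by (simp add: cd_dot_conj cd_dot_commute)
qed

section \<open>The complex structure on the orthogonal complement of \<open>C\<^sub>n\<close>\<close>

declare cd_mult.simps(2) [simp del] cd_conj.simps(2) [simp del]

text \<open>Here \<open>n = Suc m\<close>, so \<open>i\<^sub>n\<close> is the basis vector of index \<open>2 ^ m\<close>.  The components \<open>P(x)\<close> and
  \<open>Q(x)\<close> of \<open>x\<close> are \<open>cd_to_complex x\<close>, read as a complex number, and \<open>cd_perp_part x\<close>.\<close>

context
  fixes m :: nat
begin

abbreviation mul :: "cd \<Rightarrow> cd \<Rightarrow> cd"  (infixl "\<star>" 70)
  where "x \<star> y \<equiv> cd_mult (Suc m) x y"

definition cd_of_complex :: "complex \<Rightarrow> cd" where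
  "cd_of_complex z = Re z *\<^sub>R cd_one + Im z *\<^sub>R cd_i (Suc m)"

definition cd_to_complex :: "cd \<Rightarrow> complex" where
  "cd_to_complex x = Complex (lkp x 0) (lkp x (2 ^ m))"

definition cd_perp_part :: "cd \<Rightarrow> cd" where
  "cd_perp_part x = x - cd_of_complex (cd_to_complex x)"

text \<open>Complex scalars act on \<open>C\<^sub>n\<^sup>\<bottom>\<close> through left multiplication; on the rest of \<open>A\<^sub>n\<close>
  this need not be an action.\<close>

definition cd_scale :: "complex \<Rightarrow> cd \<Rightarrow> cd" where
  "cd_scale z x = cd_of_complex z \<star> x"

text \<open>Orthogonality to \<open>cd_C (Suc m)\<close> as the vanishing of two coordinates;
  \<open>cd_perp_C_eq\<close> proves the agreement with \<open>cd_perp\<close>.\<close>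

definition C_perp :: "cd set" where
  "C_perp = {x \<in> cd_carrier (Suc m). cd_to_complex x = 0}"

lemma linear_cd_of_complex: "linear cd_of_complex"
  by (rule linearI) (simp_all add: cd_of_complex_def algebra_simps)

lemma linear_cd_to_complex: "linear cd_to_complex"
  by (rule linearI) (simp_all add: cd_to_complex_def lookup_add complex_eq_iff)

lemma linear_cd_perp_part: "linear cd_perp_part"
  unfolding cd_perp_part_def
  by (intro linear_compose_sub linear_ident linear_compose[OF linear_cd_to_complex linear_cd_of_complex, unfolded o_def])

lemmas cd_of_complex_linear_simps [simp] =
  linear_add[OF linear_cd_of_complex] linear_diff[OF linear_cd_of_complex]
  linear_neg[OF linear_cd_of_complex] linear_scale[OF linear_cd_of_complex]
  linear_0[OF linear_cd_of_complex]

lemmas cd_to_complex_linear_simps [simp] =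
  linear_add[OF linear_cd_to_complex] linear_diff[OF linear_cd_to_complex]
  linear_neg[OF linear_cd_to_complex] linear_scale[OF linear_cd_to_complex]
  linear_0[OF linear_cd_to_complex]

lemmas cd_perp_part_linear_simps [simp] =
  linear_add[OF linear_cd_perp_part] linear_diff[OF linear_cd_perp_part]
  linear_neg[OF linear_cd_perp_part] linear_scale[OF linear_cd_perp_part]
  linear_0[OF linear_cd_perp_part]

lemma cd_of_complex_pair: "cd_of_complex z = cd_pair m (Re z *\<^sub>R cd_one) (Im z *\<^sub>R cd_one)"
  by (auto intro!: poly_mapping_eqI simp: cd_of_complex_def cd_i_def lookup_add lookup_cd_pair lookup_cd_one)

lemma cd_of_complex_carrier [simp, intro]: "cd_of_complex z \<in> cd_carrier (Suc m)"
  by (simp add: cd_of_complex_pair)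

lemma cd_to_complex_of_complex [simp]: "cd_to_complex (cd_of_complex z) = z"
  by (simp add: cd_of_complex_pair cd_to_complex_def lookup_cd_pair lookup_cd_one)

lemma cd_perp_part_of_complex [simp]: "cd_perp_part (cd_of_complex z) = 0"
  by (simp add: cd_perp_part_def)

lemma subspace_C_perp: "subspace C_perp"
  by (auto simp: subspace_def C_perp_def)

lemmas C_perp_closed [simp, intro] =
  subspace_add[OF subspace_C_perp] subspace_diff[OF subspace_C_perp]
  subspace_neg[OF subspace_C_perp] subspace_scale[OF subspace_C_perp]
  subspace_0[OF subspace_C_perp]

lemma C_perp_carrier [simp, intro]: "x \<in> C_perp \<Longrightarrow> x \<in> cd_carrier (Suc m)"
  and C_perp_to_complex [simp]: "x \<in> C_perp \<Longrightarrow> cd_to_complex x = 0"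
  and C_perp_perp_part [simp]: "x \<in> C_perp \<Longrightarrow> cd_perp_part x = x"
  by (auto simp: C_perp_def cd_perp_part_def)

lemma cd_perp_part_C_perp [simp, intro]: "x \<in> cd_carrier (Suc m) \<Longrightarrow> cd_perp_part x \<in> C_perp"
  unfolding C_perp_def cd_perp_part_def by simp

lemma cd_decomp: "x = cd_of_complex (cd_to_complex x) + cd_perp_part x"
  by (simp add: cd_perp_part_def)

text \<open>The indices 0 and \<open>2 ^ m\<close> carry the real parts of the two halves, so both
  halves are imaginary and conjugation only changes their signs.\<close>

lemma C_perp_cases:
  assumes "x \<in> C_perp"
  obtains p q where "x = cd_pair m p q" "p \<in> cd_carrier m" "q \<in> cd_carrier m"
    "cd_conj m p = - p" "cd_conj m q = - q"
proof -
  obtain p q where *: "x = cd_pair m p q" "p \<in> cd_carrier m" "q \<in> cd_carrier m"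
    using assms cd_carrier_pair_cases C_perp_carrier by metis
  have "cd_to_complex x = 0"
    using assms by simp
  with * have "lkp p 0 = 0" "lkp q 0 = 0"
    by (auto simp: cd_to_complex_def lookup_cd_pair complex_eq_iff)
  with * show ?thesis
    by (intro that[of p q]) (auto simp: cd_conj_eq)
qed

lemma cd_conj_C_perp [simp]: "x \<in> C_perp \<Longrightarrow> cd_conj (Suc m) x = - x"
  by (auto elim!: C_perp_cases simp: cd_conj_pair cd_pair_uminus)

lemma cd_conj_of_complex [simp]: "cd_conj (Suc m) (cd_of_complex z) = cd_of_complex (cnj z)"
proof -
  have "cd_conj m cd_one = cd_one"
    by (simp add: cd_conj_eq lookup_cd_one scaleR_2)
  then show ?thesis
    by (simp add: cd_of_complex_pair cd_conj_pair)
qed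

lemma cd_of_complex_mult: "cd_of_complex z \<star> cd_of_complex w = cd_of_complex (z * w)"
proof -
  have "cd_conj m cd_one = cd_one"
    by (simp add: cd_conj_eq lookup_cd_one scaleR_2)
  then show ?thesis
    by (simp add: cd_of_complex_pair cd_mult_pair algebra_simps)
qed

lemma cd_scale_pair:
  assumes "p \<in> cd_carrier m" "q \<in> cd_carrier m" "cd_conj m p = - p" "cd_conj m q = - q"
  shows "cd_scale z (cd_pair m p q) =
    cd_pair m (Re z *\<^sub>R p + Im z *\<^sub>R q) (Re z *\<^sub>R q - Im z *\<^sub>R p)"
  using assms by (simp add: cd_scale_def cd_of_complex_pair cd_mult_pair)

lemma mul_of_complex_pair:
  assumes "p \<in> cd_carrier m" "q \<in> cd_carrier m"
  shows "cd_pair m p q \<star> cd_of_complex z =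
    cd_pair m (Re z *\<^sub>R p - Im z *\<^sub>R q) (Re z *\<^sub>R q + Im z *\<^sub>R p)"
proof -
  have "cd_conj m cd_one = cd_one"
    by (simp add: cd_conj_eq lookup_cd_one scaleR_2)
  with assms show ?thesis
    by (simp add: cd_of_complex_pair cd_mult_pair add.commute)
qed

lemma cd_scale_C_perp [simp, intro]:
  assumes "x \<in> C_perp"
  shows "cd_scale z x \<in> C_perp"
proof -
  obtain p q where *: "x = cd_pair m p q" "p \<in> cd_carrier m" "q \<in> cd_carrier m"
    "cd_conj m p = - p" "cd_conj m q = - q"
    using assms by (rule C_perp_cases)
  have 0: "lkp y 0 = 0" if "cd_conj m y = - y" "y \<in> cd_carrier m" for y
    using lookup_cd_conj_0[OF that(2)] that(1) by simp
  have "lkp p 0 = 0" "lkp q 0 = 0"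
    using * 0 by blast+
  with * show ?thesis
    unfolding C_perp_def
    by (simp add: cd_scale_pair cd_to_complex_def lookup_cd_pair lookup_add lookup_minus complex_eq_iff)
qed

lemma cd_scale_add_left: "cd_scale (z + w) x = cd_scale z x + cd_scale w x"
  and cd_scale_diff_left: "cd_scale (z - w) x = cd_scale z x - cd_scale w x"
  and cd_scale_minus_left: "cd_scale (- z) x = - cd_scale z x"
  and cd_scale_scaleR_left: "cd_scale (r *\<^sub>R z) x = r *\<^sub>R cd_scale z x"
  and cd_scale_zero_left [simp]: "cd_scale 0 x = 0"
  and cd_scale_add: "cd_scale z (x + y) = cd_scale z x + cd_scale z y"
  and cd_scale_diff: "cd_scale z (x - y) = cd_scale z x - cd_scale z y"
  and cd_scale_minus: "cd_scale z (- x) = - cd_scale z x"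
  and cd_scale_scaleR: "cd_scale z (r *\<^sub>R x) = r *\<^sub>R cd_scale z x"
  and cd_scale_zero [simp]: "cd_scale z 0 = 0"
  by (simp_all add: cd_scale_def)

lemma cd_scale_of_real: "x \<in> cd_carrier (Suc m) \<Longrightarrow> cd_scale (of_real r) x = r *\<^sub>R x"
  by (simp add: cd_scale_def cd_of_complex_def)

lemma cd_scale_one [simp]: "x \<in> cd_carrier (Suc m) \<Longrightarrow> cd_scale 1 x = x"
  using cd_scale_of_real[of x 1] by simp

text \<open>On imaginary halves the scalar \<open>\<i>\<close> sends \<open>(p, q)\<close> to
  \<open>(q, -p)\<close>, and the square of this map is minus the identity.\<close>

lemma cd_scale_scale [simp]: "x \<in> C_perp \<Longrightarrow> cd_scale z (cd_scale w x) = cd_scale (z * w) x"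
  by (auto elim!: C_perp_cases simp: cd_scale_pair algebra_simps)

text \<open>Elements of \<open>C_perp\<close> anticommute with \<open>cd_i (Suc m)\<close>.\<close>

lemma W_mul_of_complex:
  "x \<in> C_perp \<Longrightarrow> x \<star> cd_of_complex z = cd_scale (cnj z) x"
  by (auto elim!: C_perp_cases simp: cd_scale_pair mul_of_complex_pair)

lemma carrier_mul_of_complex:
  assumes "w \<in> cd_carrier (Suc m)"
  shows "w \<star> cd_of_complex z =
    cd_of_complex (z * cd_to_complex w) + cd_scale (cnj z) (cd_perp_part w)"
proof -
  have "w \<star> cd_of_complex z = (cd_of_complex (cd_to_complex w) + cd_perp_part w) \<star> cd_of_complex z"
    by (simp flip: cd_decomp)
  then show ?thesis
    using assms by (simp add: cd_of_complex_mult W_mul_of_complex mult.commute)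
qed

lemma of_complex_mul_carrier:
  assumes "w \<in> cd_carrier (Suc m)"
  shows "cd_of_complex z \<star> w =
    cd_of_complex (z * cd_to_complex w) + cd_scale z (cd_perp_part w)"
proof -
  have "cd_of_complex z \<star> w = cd_of_complex z \<star> (cd_of_complex (cd_to_complex w) + cd_perp_part w)"
    by (simp flip: cd_decomp)
  then show ?thesis
    using assms by (simp add: cd_of_complex_mult cd_scale_def)
qed

section \<open>Behaviour of \<open>P(xy)\<close> and \<open>Q(xy)\<close> under complex scalars and
  exchange of factors\<close>

lemma scale_mul_C_perp:
  assumes "x \<in> C_perp" "y \<in> C_perp"
  shows "cd_scale z x \<star> y = (x \<star> y) \<star> cd_of_complex z"
proof -
  obtain p q where x: "x = cd_pair m p q" "p \<in> cd_carrier m" "q \<in> cd_carrier m"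
    "cd_conj m p = - p" "cd_conj m q = - q"
    using assms(1) by (rule C_perp_cases)
  obtain r s where y: "y = cd_pair m r s" "r \<in> cd_carrier m" "s \<in> cd_carrier m"
    "cd_conj m r = - r" "cd_conj m s = - s"
    using assms(2) by (rule C_perp_cases)
  show ?thesis
    using x y by (simp add: cd_scale_pair mul_of_complex_pair cd_mult_pair algebra_simps)
qed

lemma mul_scale_C_perp:
  assumes "x \<in> C_perp" "y \<in> C_perp"
  shows "x \<star> cd_scale z y = cd_of_complex (cnj z) \<star> (x \<star> y)"
proof -
  obtain p q where x: "x = cd_pair m p q" "p \<in> cd_carrier m" "q \<in> cd_carrier m"
    "cd_conj m p = - p" "cd_conj m q = - q"
    using assms(1) by (rule C_perp_cases)
  obtain r s where y: "y = cd_pair m r s" "r \<in> cd_carrier m" "s \<in> cd_carrier m"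
    "cd_conj m r = - r" "cd_conj m s = - s"
    using assms(2) by (rule C_perp_cases)
  show ?thesis
    using x y by (simp add: cd_scale_pair cd_of_complex_pair cd_mult_pair cd_conj_mult algebra_simps)
qed

text \<open>A scalar \<open>z\<close> on the left factor becomes right multiplication of the product
  by \<open>z\<close>, which acts on the \<open>C_perp\<close> part as \<open>cnj z\<close>. On the
  right factor it becomes left multiplication by \<open>cnj z\<close>, which acts as
  \<open>cnj z\<close> on both parts.\<close>

lemma to_complex_scale_mul [simp]:
    "x \<in> C_perp \<Longrightarrow> y \<in> C_perp \<Longrightarrow> cd_to_complex (cd_scale z x \<star> y) = z * cd_to_complex (x \<star> y)"
  and perp_part_scale_mul [simp]:
    "x \<in> C_perp \<Longrightarrow> y \<in> C_perp \<Longrightarrow> cd_perp_part (cd_scale z x \<star> y) = cd_scale (cnj z) (cd_perp_part (x \<star> y))"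
  and to_complex_mul_scale [simp]:
    "x \<in> C_perp \<Longrightarrow> y \<in> C_perp \<Longrightarrow> cd_to_complex (x \<star> cd_scale z y) = cnj z * cd_to_complex (x \<star> y)"
  and perp_part_mul_scale [simp]:
    "x \<in> C_perp \<Longrightarrow> y \<in> C_perp \<Longrightarrow> cd_perp_part (x \<star> cd_scale z y) = cd_scale (cnj z) (cd_perp_part (x \<star> y))"
  by (simp_all add: scale_mul_C_perp mul_scale_C_perp carrier_mul_of_complex of_complex_mul_carrier)

text \<open>Conjugation negates both factors and reverses their product, so
  \<open>y \<star> x\<close> is the conjugate of \<open>x \<star> y\<close>.\<close>

lemma to_complex_swap:
    "x \<in> C_perp \<Longrightarrow> y \<in> C_perp \<Longrightarrow> cd_to_complex (y \<star> x) = cnj (cd_to_complex (x \<star> y))"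
  and perp_part_swap:
    "x \<in> C_perp \<Longrightarrow> y \<in> C_perp \<Longrightarrow> cd_perp_part (y \<star> x) = - cd_perp_part (x \<star> y)"
proof -
  assume *: "x \<in> C_perp" "y \<in> C_perp"
  have "y \<star> x = cd_conj (Suc m) (x \<star> y)"
    using * by (simp add: cd_conj_mult)
  also have "\<dots> = cd_conj (Suc m) (cd_of_complex (cd_to_complex (x \<star> y)) + cd_perp_part (x \<star> y))"
    by (simp flip: cd_decomp)
  also have "\<dots> = cd_of_complex (cnj (cd_to_complex (x \<star> y))) - cd_perp_part (x \<star> y)"
    by simp
  finally have eq: "y \<star> x = \<dots>" .
  show "cd_to_complex (y \<star> x) = cnj (cd_to_complex (x \<star> y))"
    "cd_perp_part (y \<star> x) = - cd_perp_part (x \<star> y)"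
    unfolding eq by simp_all
qed

lemma dot_of_complex_C_perp:
  assumes "x \<in> C_perp"
  shows "cd_dot (Suc m) x (cd_of_complex z) = 0"
proof -
  obtain p q where *: "x = cd_pair m p q" "p \<in> cd_carrier m" "q \<in> cd_carrier m"
    using assms by (rule C_perp_cases)
  have "cd_to_complex x = 0"
    using assms by simp
  with * show ?thesis
    by (simp add: cd_of_complex_pair cd_dot_pair cd_dot_one cd_to_complex_def lookup_cd_pair complex_eq_iff)
qed

text \<open>As \<open>y\<close> has conjugate \<open>- y\<close>, the Hermitian product of
  \<open>x\<close> and \<open>y\<close> is \<open>- P(xy)\<close>; its real part is the real inner
  product.\<close>

lemma dot_eq_Re:
  assumes "x \<in> C_perp" "y \<in> C_perp"
  shows "cd_dot (Suc m) x y = - Re (cd_to_complex (x \<star> y))"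
proof -
  have "Re (cd_to_complex (x \<star> y)) = cd_dot (Suc m) (x \<star> y) cd_one"
    by (simp add: cd_to_complex_def cd_dot_one)
  then show ?thesis
    using assms cd_dot_commute[of "Suc m" x y] by (simp add: cd_dot_mult_left)
qed

lemma to_complex_self:
  assumes "x \<in> C_perp"
  shows "cd_to_complex (x \<star> x) = - of_real (cd_dot (Suc m) x x)"
  using to_complex_swap[OF assms assms] dot_eq_Re[OF assms assms]
  by (simp add: complex_eq_iff)

text \<open>The real inner product of \<open>Q(ax)\<close> and \<open>y\<close> is that of
  \<open>a \<star> x\<close> and \<open>y\<close>, hence up to sign that of \<open>x\<close> and
  \<open>a \<star> y\<close>. It vanishes because \<open>a \<star> y\<close> lies in the complex
  line.\<close>

lemma to_complex_perp_part_mul: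
  assumes "a \<in> C_perp" "x \<in> C_perp" "y \<in> C_perp" "cd_perp_part (a \<star> y) = 0"
  shows "cd_to_complex (cd_perp_part (a \<star> x) \<star> y) = 0"
proof -
  have Re: "Re (cd_to_complex (cd_perp_part (a \<star> x) \<star> y)) = 0"
    if y: "y \<in> C_perp" "cd_perp_part (a \<star> y) = 0" for y
  proof -
    have "cd_dot (Suc m) (cd_perp_part (a \<star> x)) y = cd_dot (Suc m) (a \<star> x) y"
      using dot_of_complex_C_perp[OF y(1)] cd_dot_commute[of "Suc m" y] by (simp add: cd_perp_part_def)
    also have "\<dots> = - cd_dot (Suc m) x (a \<star> y)"
      using assms y by (simp add: cd_dot_mult_left)
    also have "a \<star> y = cd_of_complex (cd_to_complex (a \<star> y))"
      using y(2) by (simp add: cd_perp_part_def)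
    finally show ?thesis
      using assms y by (simp add: dot_of_complex_C_perp dot_eq_Re)
  qed
  \<comment> \<open>The hypothesis on \<open>y\<close> also holds for \<open>\<i>\<close> times
    \<open>y\<close>, and this replacement exchanges real and imaginary parts.\<close>
  show ?thesis
    using Re[of y] Re[of "cd_scale \<i> y"] assms by (simp add: complex_eq_iff)
qed

lemma perp_part_self [simp]:
  assumes "a \<in> C_perp"
  shows "cd_perp_part (a \<star> a) = 0"
proof -
  have "2 *\<^sub>R cd_perp_part (a \<star> a) = 0"
    using perp_part_swap[OF assms assms] by (simp add: scaleR_2)
  then show ?thesis by simp
qed

lemma cd_eq_0_iff:
  "w = 0 \<longleftrightarrow> cd_to_complex w = 0 \<and> cd_perp_part w = 0"
  by (metis add.right_neutral cd_decomp cd_of_complex_linear_simps(5) cd_perp_part_linear_simps(5)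
      cd_to_complex_linear_simps(5))

lemma to_complex_self_eq_0:
  assumes "a \<in> C_perp"
  shows "cd_to_complex (a \<star> a) = 0 \<longleftrightarrow> a = 0"
  using assms by (simp add: to_complex_self cd_dot_self_eq_0)

text \<open>For \<open>y = z + y'\<close> the \<open>C_perp\<close> part of
  \<open>a \<star> y\<close> is \<open>cnj z\<close> times \<open>a\<close> plus
  \<open>Q(ay')\<close>. The second term is Hermitian-orthogonal to \<open>a\<close>, so pairing
  with \<open>a\<close> forces \<open>z = 0\<close>.\<close>

lemma cd_Ann_subset_C_perp:
  assumes a: "a \<in> C_perp" "a \<noteq> 0"
  shows "cd_Ann (Suc m) a \<subseteq> C_perp"
proof
  fix y assume "y \<in> cd_Ann (Suc m) a"
  then have y: "y \<in> cd_carrier (Suc m)" "a \<star> y = 0"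
    by (auto simp: cd_Ann_def)
  define z where "z = cd_to_complex y"
  define y' where "y' = cd_perp_part y"
  have y': "y' \<in> C_perp" "y = cd_of_complex z + y'"
    using y cd_decomp[of y] by (auto simp: y'_def z_def)
  have "cd_scale (cnj z) a + cd_perp_part (a \<star> y') = cd_perp_part (a \<star> y)"
    using a y' by (simp add: W_mul_of_complex)
  then have "cd_scale (cnj z) a + cd_perp_part (a \<star> y') = 0"
    using y by simp
  then have "cd_to_complex ((cd_scale (cnj z) a + cd_perp_part (a \<star> y')) \<star> a) = 0"
    by simp
  then have "cnj z * cd_to_complex (a \<star> a) = 0"
    using a y' to_complex_perp_part_mul[of a y' a] by simp
  then have "z = 0"
    using a by (simp add: to_complex_self_eq_0)
  then show "y \<in> C_perp"
    using y' by simp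
qed

section \<open>The equations for a vanishing product\<close>

lemma pair_mul_eq_0_iff:
  assumes u: "u \<in> C_perp" and v: "v \<in> C_perp" and s: "s \<in> C_perp" and t: "t \<in> C_perp"
  shows "cd_mult (Suc (Suc m)) (cd_pair (Suc m) u (cd_scale \<i> v))
      (cd_pair (Suc m) (cd_of_complex z + s) (cd_of_complex w + cd_scale \<i> t)) = 0 \<longleftrightarrow>
    cd_to_complex (u \<star> s) + cd_to_complex (t \<star> v) = 0 \<and>
    cd_to_complex (t \<star> u) = cd_to_complex (v \<star> s) \<and>
    cd_scale (cnj z) u - cd_scale (\<i> * cnj w) v + cd_perp_part (u \<star> s) + cd_perp_part (v \<star> t) = 0 \<and>
    cd_scale (\<i> * w) u - cd_scale z v - cd_perp_part (u \<star> t) - cd_perp_part (v \<star> s) = 0"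
proof -
  let ?x = "cd_of_complex z + s" and ?y = "cd_of_complex w + cd_scale \<i> t"
  define F where "F = u \<star> ?x - cd_conj (Suc m) ?y \<star> cd_scale \<i> v"
  define G where "G = ?y \<star> u + cd_scale \<i> v \<star> cd_conj (Suc m) ?x"
  have car: "F \<in> cd_carrier (Suc m)" "G \<in> cd_carrier (Suc m)"
    by (auto simp: F_def G_def)
  have [simp]: "cd_of_complex w \<star> x = cd_scale w x" for w x
    by (simp add: cd_scale_def)
  have "cd_mult (Suc (Suc m)) (cd_pair (Suc m) u (cd_scale \<i> v)) (cd_pair (Suc m) ?x ?y)
      = cd_pair (Suc m) F G"
    unfolding F_def G_def using assms by (intro cd_mult_pair) auto
  also have "\<dots> = 0 \<longleftrightarrow> F = 0 \<and> G = 0"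
    using cd_pair_eq_iff[OF car, of 0 0] by simp
  \<comment> \<open>Multiplying the second \<open>C_perp\<close> equation by the invertible scalar
    \<open>\<i>\<close> clears the factor \<open>- \<i>\<close> from its products.\<close>
  also have "\<dots> \<longleftrightarrow> (cd_to_complex F = 0 \<and> cd_to_complex G = 0) \<and> cd_perp_part F = 0 \<and> cd_scale \<i> (cd_perp_part G) = 0"
  proof -
    have "cd_scale \<i> (cd_perp_part G) = 0 \<longleftrightarrow> cd_perp_part G = 0"
    proof
      assume "cd_scale \<i> (cd_perp_part G) = 0"
      then have "cd_scale (- \<i>) (cd_scale \<i> (cd_perp_part G)) = 0" by simp
      then show "cd_perp_part G = 0" using car by simp
    qed simp
    then show ?thesis
      using cd_eq_0_iff[of F] cd_eq_0_iff[of G] by blast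
  qed
  also have "cd_to_complex F = cd_to_complex (u \<star> s) + cd_to_complex (t \<star> v)"
    using assms by (simp add: F_def W_mul_of_complex)
  also have "cd_to_complex G = \<i> * (cd_to_complex (t \<star> u) - cd_to_complex (v \<star> s))"
    using assms by (simp add: G_def W_mul_of_complex right_diff_distrib)
  also have "cd_perp_part F = cd_scale (cnj z) u - cd_scale (\<i> * cnj w) v + cd_perp_part (u \<star> s) + cd_perp_part (v \<star> t)"
    using assms perp_part_swap[OF v t]
    by (simp add: F_def W_mul_of_complex mult.commute cd_scale_minus_left cd_scale_minus)
  also have "cd_scale \<i> (cd_perp_part G) = cd_scale (\<i> * w) u - cd_scale z v - cd_perp_part (u \<star> t) - cd_perp_part (v \<star> s)"
  proof -
    have "cd_perp_part G = cd_scale w u + cd_scale (z * \<i>) v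
        + cd_scale (- \<i>) (cd_perp_part (t \<star> u)) - cd_scale (- \<i>) (cd_perp_part (v \<star> s))"
      using assms by (simp add: G_def W_mul_of_complex)
    moreover have "\<i> * (z * \<i>) = - z"
      by (simp add: complex_eq_iff)
    ultimately show ?thesis
      using assms perp_part_swap[OF u t] by (simp add: cd_scale_add cd_scale_diff cd_scale_minus_left cd_scale_minus)
  qed
  finally show ?thesis by simp
qed

lemma add_diff_eq_0_iff:
  fixes p q :: "'a::real_vector"
  shows "p = 0 \<and> q = 0 \<longleftrightarrow> p + q = 0 \<and> p - q = 0"
proof safe
  assume "p + q = 0" "p - q = 0"
  then have "2 *\<^sub>R p = 0" "p = q" by (simp_all add: scaleR_2)
  then show "p = 0" "q = 0" by simp_all
qed simp_all

section \<open>Annihilators of \<open>{a, b}\<close>\<close>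

text \<open>The left factor is \<open>{a, b}\<close> without its factor \<open>1 / sqrt 2\<close>; the right factor is a general
  element of \<open>A\<^sub>n\<^sub>+\<^sub>1\<close>, whose part in \<open>H\<^sub>n\<^sub>+\<^sub>1\<close> is given by \<open>z\<close> and \<open>w\<close>.\<close>

lemma brace_mul_eq_0_iff:
  assumes a: "a \<in> C_perp" and b: "b \<in> C_perp" and x: "x \<in> C_perp" and y: "y \<in> C_perp"
  shows "cd_mult (Suc (Suc m)) (cd_pair (Suc m) (a + b) (cd_scale \<i> (b - a)))
      (cd_pair (Suc m) (cd_of_complex z + (x + y)) (cd_of_complex w + cd_scale \<i> (y - x))) = 0 \<longleftrightarrow>
    cd_to_complex (b \<star> y) = - cnj (cd_to_complex (a \<star> x)) \<and>
    cd_to_complex (b \<star> x) = cnj (cd_to_complex (a \<star> y)) \<and>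
    2 *\<^sub>R cd_perp_part (a \<star> x) = cd_scale (Complex (Im w) (Im z)) b - cd_scale (Complex (Re z) (Re w)) a \<and>
    2 *\<^sub>R cd_perp_part (b \<star> y) = - cd_scale (Complex (Im w) (- Im z)) a - cd_scale (Complex (Re z) (- Re w)) b"
    (is "?prod = 0 \<longleftrightarrow> ?C1 \<and> ?C2 \<and> ?E1 \<and> ?E2")
proof -
  let ?u = "a + b" and ?v = "b - a" and ?s = "x + y" and ?t = "y - x"
  define e f where "e = cd_scale (cnj z) ?u - cd_scale (\<i> * cnj w) ?v + cd_perp_part (?u \<star> ?s) + cd_perp_part (?v \<star> ?t)"
    and "f = cd_scale (\<i> * w) ?u - cd_scale z ?v - cd_perp_part (?u \<star> ?t) - cd_perp_part (?v \<star> ?s)"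
  have "?prod = 0 \<longleftrightarrow> (cd_to_complex (?u \<star> ?s) + cd_to_complex (?t \<star> ?v) = 0 \<and>
      cd_to_complex (?t \<star> ?u) = cd_to_complex (?v \<star> ?s)) \<and> e = 0 \<and> f = 0"
    unfolding e_def f_def using assms by (subst pair_mul_eq_0_iff) auto
  also have "(cd_to_complex (?u \<star> ?s) + cd_to_complex (?t \<star> ?v) = 0 \<and>
      cd_to_complex (?t \<star> ?u) = cd_to_complex (?v \<star> ?s)) \<longleftrightarrow> ?C1 \<and> ?C2"
    unfolding to_complex_swap[OF C_perp_closed(2)[OF b a] C_perp_closed(2)[OF y x]]
      to_complex_swap[OF C_perp_closed(1)[OF a b] C_perp_closed(2)[OF y x]]
    by (auto simp: complex_eq_iff)
  \<comment> \<open>Sum and difference separate the unknowns: \<open>?u - ?v = 2a\<close> and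
    \<open>?s - ?t = 2x\<close> turn the products in \<open>e + f\<close> into
    \<open>4 Q(ax)\<close>, while \<open>?u + ?v = 2b\<close> and \<open>?s + ?t = 2y\<close> give
    \<open>4 Q(by)\<close> in \<open>e - f\<close>.\<close>
  also have "e = 0 \<and> f = 0 \<longleftrightarrow> e + f = 0 \<and> e - f = 0"
    by (rule add_diff_eq_0_iff)
  also have "e + f = 2 *\<^sub>R (2 *\<^sub>R cd_perp_part (a \<star> x) -
      (cd_scale (Complex (Im w) (Im z)) b - cd_scale (Complex (Re z) (Re w)) a))"
  proof -
    have *: "Complex (Im w) (Im z) = (1/2) *\<^sub>R (\<i> * cnj w + z - cnj z - \<i> * w)"
      "Complex (Re z) (Re w) = (1/2) *\<^sub>R (\<i> * cnj w + z + cnj z + \<i> * w)"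
      by (simp_all add: complex_eq_iff)
    show ?thesis
      unfolding e_def f_def *
      by (simp add: cd_scale_add_left cd_scale_diff_left cd_scale_scaleR_left cd_scale_add cd_scale_diff
        algebra_simps scaleR_2)
  qed
  also have "e - f = 2 *\<^sub>R (2 *\<^sub>R cd_perp_part (b \<star> y) -
      (- cd_scale (Complex (Im w) (- Im z)) a - cd_scale (Complex (Re z) (- Re w)) b))"
  proof -
    have *: "Complex (Im w) (- Im z) = (1/2) *\<^sub>R (\<i> * cnj w - z + cnj z - \<i> * w)"
      "Complex (Re z) (- Re w) = (1/2) *\<^sub>R (- \<i> * cnj w + z + cnj z - \<i> * w)"
      by (simp_all add: complex_eq_iff)
    show ?thesis
      unfolding e_def f_def *
      by (simp add: cd_scale_add_left cd_scale_diff_left cd_scale_scaleR_left cd_scale_add cd_scale_diff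
        cd_scale_minus_left algebra_simps scaleR_2)
  qed
  finally show ?thesis
    by simp
qed

section \<open>Vanishing of the \<open>H\<close> part outside the D-locus\<close>

text \<open>The D-locus conditions in complex form: entire Hermitian products vanish, not just their
  real parts. By \<open>brace_in_D_locus\<close> this fails for nonzero \<open>a\<close> and
  \<open>b\<close> in \<open>C_perp\<close> whenever \<open>{a, b}\<close> lies outside the
  D-locus.\<close>

definition D_condition :: "cd \<Rightarrow> cd \<Rightarrow> bool" where
  "D_condition a b \<longleftrightarrow> cd_to_complex (a \<star> b) = 0 \<and>
    (\<forall>k\<in>cd_Ann (Suc m) b. cd_to_complex (a \<star> k) = 0) \<and>
    (\<forall>k\<in>cd_Ann (Suc m) a. cd_to_complex (b \<star> k) = 0)"

lemma not_D_condition_cases: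
  assumes "a \<in> C_perp" "b \<in> C_perp" "a \<noteq> 0" "b \<noteq> 0" "\<not> D_condition a b"
  obtains "cd_to_complex (a \<star> b) \<noteq> 0"
  | k where "k \<in> C_perp" "b \<star> k = 0" "cd_to_complex (a \<star> k) \<noteq> 0"
  | k where "k \<in> C_perp" "a \<star> k = 0" "cd_to_complex (b \<star> k) \<noteq> 0"
proof -
  have *: "k \<in> C_perp \<and> c \<star> k = 0" if "k \<in> cd_Ann (Suc m) c" "c \<in> C_perp" "c \<noteq> 0" for k c
    using that cd_Ann_subset_C_perp[of c] by (auto simp: cd_Ann_def)
  show thesis
    using assms that * unfolding D_condition_def by metis
qed

lemma dot_self_add_ne_0:
  assumes "a \<in> C_perp" "b \<in> C_perp" "a \<noteq> 0"
  shows "cd_dot (Suc m) a a + cd_dot (Suc m) b b \<noteq> 0"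
  using assms cd_dot_self_nonneg[of "Suc m" a] cd_dot_self_nonneg[of "Suc m" b]
    cd_dot_self_eq_0[of a "Suc m"] by auto

text \<open>Pairing \<open>eqa\<close> with a \<open>k\<close> for which \<open>Q(ak) = 0\<close>,
  or \<open>eqb\<close> with a \<open>k\<close> for which \<open>Q(bk) = 0\<close>, removes the left
  side and leaves a linear relation between the coefficients. Suitable \<open>k\<close> are
  \<open>a\<close>, \<open>b\<close> and elements of the annihilators.\<close>

lemma brace_mul_H_part_eq_0:
  assumes a: "a \<in> C_perp" "a \<noteq> 0" and b: "b \<in> C_perp" "b \<noteq> 0" and x: "x \<in> C_perp" and y: "y \<in> C_perp"
    and D: "\<not> D_condition a b"
    and eqa: "2 *\<^sub>R cd_perp_part (a \<star> x) = cd_scale \<epsilon> b - cd_scale \<gamma> a"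
    and eqb: "2 *\<^sub>R cd_perp_part (b \<star> y) = - cd_scale (cnj \<epsilon>) a - cd_scale (cnj \<gamma>) b"
  shows "\<epsilon> = 0 \<and> \<gamma> = 0"
proof -
  have A: "\<epsilon> * cd_to_complex (b \<star> k) = \<gamma> * cd_to_complex (a \<star> k)"
    if k: "k \<in> C_perp" "cd_perp_part (a \<star> k) = 0" for k
  proof -
    have "cd_to_complex ((2 *\<^sub>R cd_perp_part (a \<star> x)) \<star> k) = 0"
      using to_complex_perp_part_mul[OF a(1) x k] by simp
    then show ?thesis
      unfolding eqa using a b k by simp
  qed
  have B: "cnj \<epsilon> * cd_to_complex (a \<star> k) = - cnj \<gamma> * cd_to_complex (b \<star> k)"
    if k: "k \<in> C_perp" "cd_perp_part (b \<star> k) = 0" for k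
  proof -
    have "cd_to_complex ((2 *\<^sub>R cd_perp_part (b \<star> y)) \<star> k) = 0"
      using to_complex_perp_part_mul[OF b(1) y k] by simp
    then show ?thesis
      unfolding eqb using a b k by simp (metis minus_minus)
  qed
  have Aa: "\<epsilon> * cd_to_complex (b \<star> a) = \<gamma> * cd_to_complex (a \<star> a)"
    by (rule A) (use a in auto)
  have Bb: "cnj \<epsilon> * cd_to_complex (a \<star> b) = - cnj \<gamma> * cd_to_complex (b \<star> b)"
    by (rule B) (use b in auto)
  \<comment> \<open>As \<open>P(aa)\<close> is nonzero, \<open>Aa\<close> determines
    \<open>\<gamma>\<close> from \<open>\<epsilon>\<close>; so when an annihilator supplies
    \<open>k\<close>, it is enough to obtain \<open>\<epsilon> = 0\<close>.\<close>
  have zero: "\<epsilon> = 0 \<and> \<gamma> = 0" if "\<epsilon> = 0"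
    using that Aa a to_complex_self_eq_0[OF a(1)] by simp
  from a(1) b(1) a(2) b(2) D show ?thesis
  proof (cases rule: not_D_condition_cases)
    case 1
    \<comment> \<open>The conjugate of \<open>Bb\<close> and \<open>Aa\<close> express
      \<open>\<epsilon> P(ba)\<close> as \<open>\<gamma>\<close> times the squared norm of
      \<open>b\<close> and as \<open>- \<gamma>\<close> times that of \<open>a\<close>.\<close>
    have "cnj (cnj \<epsilon> * cd_to_complex (a \<star> b)) = cnj (- cnj \<gamma> * cd_to_complex (b \<star> b))"
      using Bb by simp
    then have "\<epsilon> * cd_to_complex (b \<star> a) = \<gamma> * of_real (cd_dot (Suc m) b b)"
      using a b by (simp add: to_complex_self to_complex_swap[of a b])
    then have "\<gamma> * of_real (cd_dot (Suc m) a a + cd_dot (Suc m) b b) = 0"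
      using Aa a by (simp add: to_complex_self distrib_left neg_eq_iff_add_eq_0)
    then have "\<gamma> = 0"
      using dot_self_add_ne_0[of a b] a b
      by (metis mult_eq_0_iff of_real_eq_0_iff)
    then show ?thesis
      using Bb 1 by simp
  next
    case (2 k)
    then show ?thesis
      using B[of k] zero by simp
  next
    case (3 k)
    then show ?thesis
      using A[of k] zero by simp
  qed
qed

section \<open>Dimension of the space of pairs \<open>(x, y)\<close>\<close>

text \<open>The space \<open>K\<close>: the equations of \<open>brace_mul_eq_0_iff\<close> for
  \<open>z = w = 0\<close>, except the one that couples \<open>b \<star> x\<close> with
  \<open>a \<star> y\<close>.\<close>

definition annihilator_pairs :: "cd \<Rightarrow> cd \<Rightarrow> (cd \<times> cd) set" where
  "annihilator_pairs a b = {(x, y). x \<in> C_perp \<and> y \<in> C_perp \<and>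
    cd_perp_part (a \<star> x) = 0 \<and> cd_perp_part (b \<star> y) = 0 \<and>
    cd_to_complex (b \<star> y) = - cnj (cd_to_complex (a \<star> x))}"

lemma subspace_annihilator_pairs: "subspace (annihilator_pairs a b)"
  by (auto simp: subspace_def annihilator_pairs_def zero_prod_def)

text \<open>With the conjugate scalar on \<open>y\<close>, both sides of the condition linking
  \<open>P(by)\<close> to \<open>P(ax)\<close> acquire the factor \<open>z\<close>.\<close>

lemma annihilator_pairs_scale:
  assumes "a \<in> C_perp" "b \<in> C_perp" "(x, y) \<in> annihilator_pairs a b"
  shows "(cd_scale z x, cd_scale (cnj z) y) \<in> annihilator_pairs a b"
  using assms by (auto simp: annihilator_pairs_def)

lemma finite_span_cd_carrier: "\<exists>E. finite E \<and> cd_carrier n \<subseteq> span E"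
proof (intro exI conjI subsetI)
  let ?E = "(\<lambda>i. Poly_Mapping.single i (1::real)) ` {..<(2::nat) ^ n}"
  show "finite ?E" by simp
  fix x assume x: "x \<in> cd_carrier n"
  have "x = (\<Sum>i<(2::nat) ^ n. lkp x i *\<^sub>R Poly_Mapping.single i 1)"
  proof (rule poly_mapping_eqI)
    fix k
    have "lkp (\<Sum>i<(2::nat) ^ n. lkp x i *\<^sub>R Poly_Mapping.single i 1) k = (\<Sum>i<(2::nat) ^ n. if i = k then lkp x i else 0)"
      unfolding lookup_sum by (intro sum.cong) (auto simp: lookup_single when_def)
    also have "\<dots> = lkp x k"
      using x unfolding cd_carrier_iff by (simp add: not_less)
    finally show "lkp x k = lkp (\<Sum>i<(2::nat) ^ n. lkp x i *\<^sub>R Poly_Mapping.single i 1) k" by simp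
  qed
  also have "\<dots> \<in> span ?E"
    by (intro span_sum span_scale span_base) auto
  finally show "x \<in> span ?E" .
qed

lemma finite_span_annihilator_pairs: "\<exists>E. finite E \<and> annihilator_pairs a b \<subseteq> span E"
proof -
  obtain E where E: "finite E" "cd_carrier (Suc m) \<subseteq> span E"
    using finite_span_cd_carrier by blast
  have "annihilator_pairs a b \<subseteq> cd_carrier (Suc m) \<times> cd_carrier (Suc m)"
    by (auto simp: annihilator_pairs_def)
  also have "\<dots> \<subseteq> span (E \<times> {0} \<union> {0} \<times> E)"
    using E by (intro Times_subset_span)
  finally show ?thesis
    using E(1) by (intro exI[of _ "E \<times> {0} \<union> {0} \<times> E"]) simp
qed

text \<open>Rank-nullity for \<open>(x, y) \<mapsto> P(ax)\<close>. On the kernel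
  \<open>P(by)\<close> vanishes too, which leaves the product of the annihilators; the image is the
  complex plane, of real dimension 2.\<close>

lemma dim_annihilator_pairs:
  assumes a: "a \<in> C_perp" "a \<noteq> 0" and b: "b \<in> C_perp" "b \<noteq> 0"
  shows "dim (annihilator_pairs a b) = dim (cd_Ann (Suc m) a) + dim (cd_Ann (Suc m) b) + 2"
proof -
  obtain E where E: "finite E" "annihilator_pairs a b \<subseteq> span E"
    using finite_span_annihilator_pairs by blast
  obtain E' where E': "finite E'" "cd_carrier (Suc m) \<subseteq> span E'"
    using finite_span_cd_carrier by blast
  let ?f = "\<lambda>p. cd_to_complex (a \<star> fst p)"
  have lin: "linear ?f"
    by (rule linearI) auto
  have Ann: "subspace (cd_Ann (Suc m) c)" "cd_Ann (Suc m) c \<subseteq> span E'" for c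
    using E' by (auto simp: subspace_def cd_Ann_def)
  have ker: "{p \<in> annihilator_pairs a b. ?f p = 0} = cd_Ann (Suc m) a \<times> cd_Ann (Suc m) b"
  proof (intro set_eqI iffI)
    fix p assume "p \<in> {p \<in> annihilator_pairs a b. ?f p = 0}"
    then show "p \<in> cd_Ann (Suc m) a \<times> cd_Ann (Suc m) b"
      using cd_eq_0_iff[of "a \<star> fst p"] cd_eq_0_iff[of "b \<star> snd p"]
      by (cases p) (auto simp: annihilator_pairs_def cd_Ann_def)
  next
    fix p assume p: "p \<in> cd_Ann (Suc m) a \<times> cd_Ann (Suc m) b"
    then have "fst p \<in> C_perp" "snd p \<in> C_perp"
      using cd_Ann_subset_C_perp[OF a] cd_Ann_subset_C_perp[OF b] by auto
    then show "p \<in> {p \<in> annihilator_pairs a b. ?f p = 0}"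
      using p by (cases p) (auto simp: annihilator_pairs_def cd_Ann_def)
  qed
  have "?f ` annihilator_pairs a b = UNIV"
  proof (intro antisym subset_UNIV subsetI)
    fix c :: complex
    let ?A = "cd_to_complex (a \<star> a)" and ?B = "cd_to_complex (b \<star> b)"
    \<comment> \<open>Multiples of \<open>a\<close> and \<open>b\<close> make \<open>Q(ax)\<close>
      and \<open>Q(by)\<close> vanish; the coefficients are chosen so that \<open>P(ax) = c\<close>
      and \<open>P(by) = - cnj c\<close>.\<close>
    define x y where "x = cd_scale (cnj (c / ?A)) a" and "y = cd_scale (- (c / cnj ?B)) b"
    have "?A \<noteq> 0" "?B \<noteq> 0"
      using a b by (auto simp: to_complex_self_eq_0)
    then have "(x, y) \<in> annihilator_pairs a b" "c = ?f (x, y)"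
      using a b by (auto simp: x_def y_def annihilator_pairs_def)
    then show "c \<in> ?f ` annihilator_pairs a b"
      by (rule image_eqI[rotated])
  qed
  then show ?thesis
    using dim_kernel_image[OF lin subspace_annihilator_pairs E(2,1)]
      dim_Times[OF Ann E'(1) Ann E'(1), of a b]
    by (simp add: ker)
qed

text \<open>The coupling condition is the kernel of \<open>?f\<close>. Scaling a pair by
  \<open>z\<close> and \<open>cnj z\<close> multiplies \<open>?f\<close> by \<open>cnj z\<close>, so
  one nonzero value makes \<open>?f\<close> onto, and its rank 2 cancels the 2 in
  \<open>dim_annihilator_pairs\<close>.\<close>

lemma dim_coupled_annihilator_pairs:
  assumes a: "a \<in> C_perp" "a \<noteq> 0" and b: "b \<in> C_perp" "b \<noteq> 0" and D: "\<not> D_condition a b"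
  shows "dim {p \<in> annihilator_pairs a b. cd_to_complex (b \<star> fst p) = cnj (cd_to_complex (a \<star> snd p))}
    = dim (cd_Ann (Suc m) a) + dim (cd_Ann (Suc m) b)"
proof -
  obtain E where E: "finite E" "annihilator_pairs a b \<subseteq> span E"
    using finite_span_annihilator_pairs by blast
  let ?f = "\<lambda>p. cd_to_complex (b \<star> fst p) - cnj (cd_to_complex (a \<star> snd p))"
  have lin: "linear ?f"
    by (rule linearI) (auto simp: algebra_simps)
  have "\<exists>p\<in>annihilator_pairs a b. ?f p \<noteq> 0"
    using a(1) b(1) a(2) b(2) D
  proof (cases rule: not_D_condition_cases)
    case 1
    define \<alpha> \<beta> where "\<alpha> = cd_dot (Suc m) a a" and "\<beta> = cd_dot (Suc m) b b"
    \<comment> \<open>The squared norms are crossed so that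
      \<open>P(ax) = - \<alpha> \<beta>\<close> and \<open>P(by) = \<alpha> \<beta>\<close>, as
      membership demands.\<close>
    let ?p = "(\<beta> *\<^sub>R a, - \<alpha> *\<^sub>R b)"
    have "?p \<in> annihilator_pairs a b"
      using a b by (auto simp: annihilator_pairs_def to_complex_self \<alpha>_def \<beta>_def scaleR_conv_of_real)
    moreover have "?f ?p = (\<alpha> + \<beta>) *\<^sub>R cnj (cd_to_complex (a \<star> b))"
      using a b by (simp add: to_complex_swap[of a b] algebra_simps)
    moreover have "\<alpha> + \<beta> \<noteq> 0"
      using dot_self_add_ne_0 a b by (auto simp: \<alpha>_def \<beta>_def)
    ultimately show ?thesis
      using 1 by (intro bexI[of _ ?p]) auto
  next
    case (2 k)
    then show ?thesis
      by (intro bexI[of _ "(0, k)"]) (auto simp: annihilator_pairs_def)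
  next
    case (3 k)
    then show ?thesis
      by (intro bexI[of _ "(k, 0)"]) (auto simp: annihilator_pairs_def)
  qed
  then obtain x y where xy: "(x, y) \<in> annihilator_pairs a b" "?f (x, y) \<noteq> 0"
    by auto
  then have W: "x \<in> C_perp" "y \<in> C_perp"
    by (auto simp: annihilator_pairs_def)
  have "?f ` annihilator_pairs a b = UNIV"
  proof (intro antisym subset_UNIV subsetI)
    fix c :: complex
    define z where "z = cnj (c / ?f (x, y))"
    have "?f (cd_scale z x, cd_scale (cnj z) y) = cnj z * ?f (x, y)"
      using a b W by (simp add: algebra_simps)
    also have "\<dots> = c"
      using xy(2) by (simp add: z_def)
    finally have "c = ?f (cd_scale z x, cd_scale (cnj z) y)" ..
    then show "c \<in> ?f ` annihilator_pairs a b"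
      by (rule image_eqI) (rule annihilator_pairs_scale[OF a(1) b(1) xy(1)])
  qed
  then show ?thesis
    using dim_kernel_image[OF lin subspace_annihilator_pairs E(2,1)] dim_annihilator_pairs[OF a b]
    by simp
qed

section \<open>From pairs to the annihilator of \<open>{a, b}\<close>\<close>

text \<open>After the complex parts are split off, the equations \<open>p + q = f'\<close> and
  \<open>\<i> (q - p) = g'\<close> are solved for \<open>p\<close> and \<open>q\<close>.\<close>

lemma carrier_Suc_Suc_cases:
  assumes "y \<in> cd_carrier (Suc (Suc m))"
  obtains z w p q where "p \<in> C_perp" "q \<in> C_perp"
    "y = cd_pair (Suc m) (cd_of_complex z + (p + q)) (cd_of_complex w + cd_scale \<i> (q - p))"
proof -
  obtain f g where fg: "f \<in> cd_carrier (Suc m)" "g \<in> cd_carrier (Suc m)" "y = cd_pair (Suc m) f g"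
    using assms by (rule cd_carrier_pair_cases)
  define f' g' where "f' = cd_perp_part f" and "g' = cd_perp_part g"
  define p q where "p = (1 / 2) *\<^sub>R (f' + cd_scale \<i> g')" and "q = (1 / 2) *\<^sub>R (f' - cd_scale \<i> g')"
  have W: "f' \<in> C_perp" "g' \<in> C_perp"
    using fg by (auto simp: f'_def g'_def)
  have "p + q = f'"
    by (simp add: p_def q_def algebra_simps flip: scaleR_add_left)
  moreover have "q - p = - cd_scale \<i> g'"
    by (simp add: p_def q_def algebra_simps flip: scaleR_add_left)
  then have "cd_scale \<i> (q - p) = g'"
    using W by (simp add: cd_scale_minus cd_scale_minus_left)
  ultimately show thesis
    using that[of p q "cd_to_complex f" "cd_to_complex g"] W fg cd_decomp[of f] cd_decomp[of g]
    by (auto simp: f'_def g'_def p_def q_def)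
qed

lemma Ann_brace_eq:
  assumes a: "a \<in> C_perp" "a \<noteq> 0" and b: "b \<in> C_perp" "b \<noteq> 0" and D: "\<not> D_condition a b"
  shows "cd_Ann (Suc (Suc m)) (cd_pair (Suc m) (a + b) (cd_scale \<i> (b - a))) =
    (\<lambda>p. cd_pair (Suc m) (fst p + snd p) (cd_scale \<i> (snd p - fst p))) `
      {p \<in> annihilator_pairs a b. cd_to_complex (b \<star> fst p) = cnj (cd_to_complex (a \<star> snd p))}"
    (is "?Ann = ?G ` ?K")
proof (intro antisym subsetI)
  fix v assume "v \<in> ?Ann"
  then have v: "v \<in> cd_carrier (Suc (Suc m))"
    "cd_mult (Suc (Suc m)) (cd_pair (Suc m) (a + b) (cd_scale \<i> (b - a))) v = 0"
    by (auto simp: cd_Ann_def)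
  obtain z w x y where xy: "x \<in> C_perp" "y \<in> C_perp"
    and v_eq: "v = cd_pair (Suc m) (cd_of_complex z + (x + y)) (cd_of_complex w + cd_scale \<i> (y - x))"
    using v(1) by (rule carrier_Suc_Suc_cases)
  note eqs = v(2)[unfolded v_eq brace_mul_eq_0_iff[OF a(1) b(1) xy]]
  \<comment> \<open>The coefficients in the two \<open>Q\<close> equations are conjugate, as
    \<open>brace_mul_H_part_eq_0\<close> requires. Together they carry all four real coordinates of
    the \<open>H\<close> part.\<close>
  have "Complex (Im w) (- Im z) = cnj (Complex (Im w) (Im z))" "Complex (Re z) (- Re w) = cnj (Complex (Re z) (Re w))"
    by (auto simp: complex_eq_iff)
  then have "Complex (Im w) (Im z) = 0 \<and> Complex (Re z) (Re w) = 0"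
    using eqs by (intro brace_mul_H_part_eq_0[OF a b xy D]) auto
  then have zw: "z = 0" "w = 0"
    by (auto simp: complex_eq_iff)
  then have "Complex (Im w) (Im z) = 0" "Complex (Re z) (Re w) = 0" "Complex (Im w) (- Im z) = 0"
    "Complex (Re z) (- Re w) = 0"
    by (auto simp: complex_eq_iff)
  then have "(x, y) \<in> ?K"
    using eqs xy by (simp add: annihilator_pairs_def)
  moreover have "v = ?G (x, y)"
    using zw v_eq by simp
  ultimately show "v \<in> ?G ` ?K"
    by (rule image_eqI[rotated])
next
  fix v assume "v \<in> ?G ` ?K"
  then obtain x y where K: "(x, y) \<in> ?K" and v: "v = cd_pair (Suc m) (x + y) (cd_scale \<i> (y - x))"
    by auto
  then have xy: "x \<in> C_perp" "y \<in> C_perp"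
    by (auto simp: annihilator_pairs_def)
  have "Complex 0 0 = 0"
    by (simp add: complex_eq_iff)
  then show "v \<in> ?Ann"
    using brace_mul_eq_0_iff[OF a(1) b(1) xy, of 0 0] K
    by (simp add: v cd_Ann_def annihilator_pairs_def)
qed

lemma dim_Ann_brace:
  assumes a: "a \<in> C_perp" "a \<noteq> 0" and b: "b \<in> C_perp" "b \<noteq> 0" and D: "\<not> D_condition a b"
  shows "dim (cd_Ann (Suc (Suc m)) (cd_pair (Suc m) (a + b) (cd_scale \<i> (b - a)))) =
    dim (cd_Ann (Suc m) a) + dim (cd_Ann (Suc m) b)"
proof -
  let ?K = "{p \<in> annihilator_pairs a b. cd_to_complex (b \<star> fst p) = cnj (cd_to_complex (a \<star> snd p))}"
  let ?G = "\<lambda>p. cd_pair (Suc m) (fst p + snd p) (cd_scale \<i> (snd p - fst p))"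
  obtain E where E: "finite E" "annihilator_pairs a b \<subseteq> span E"
    using finite_span_annihilator_pairs by blast
  have "linear ?G"
    by (rule linearI) (auto simp: cd_scale_add cd_scale_diff cd_scale_scaleR algebra_simps
        simp flip: cd_pair_add cd_pair_scaleR)
  moreover have "subspace ?K"
    using subspace_annihilator_pairs[of a b] by (auto simp: subspace_def)
  moreover have "?K \<subseteq> span E"
    using E by auto
  moreover have "p = 0" if "p \<in> ?K" "?G p = 0" for p
  proof -
    obtain x y where p: "p = (x, y)" by (cases p)
    have W: "x \<in> C_perp" "y \<in> C_perp"
      using that p by (auto simp: annihilator_pairs_def)
    have "x + y = 0" "cd_scale \<i> (y - x) = 0"
      using that(2) cd_pair_eq_iff[of "x + y" "Suc m" "cd_scale \<i> (y - x)" 0 0] W by (auto simp: p)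
    moreover from this have "cd_scale (- \<i>) (cd_scale \<i> (y - x)) = 0" by simp
    then have "y - x = 0"
      using W by (subst (asm) cd_scale_scale) auto
    ultimately show ?thesis
      using add_diff_eq_0_iff[of y x] by (auto simp: p add.commute zero_prod_def)
  qed
  ultimately have "dim (?G ` ?K) = dim ?K"
    using E(1) dim_inj_on_image[of ?G ?K E] by blast
  then show ?thesis
    by (simp add: Ann_brace_eq[OF assms] dim_coupled_annihilator_pairs[OF assms])
qed

section \<open>Translation to the original definitions\<close>

lemma cd_C_eq: "cd_C (Suc m) = range cd_of_complex"
proof
  have "cd_one = cd_of_complex 1" "cd_i (Suc m) = cd_of_complex \<i>"
    by (auto simp: cd_of_complex_def)
  then show "cd_C (Suc m) \<subseteq> range cd_of_complex"
    unfolding cd_C_def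
    by (intro span_minimal linear_subspace_image[OF linear_cd_of_complex subspace_UNIV])
      (metis empty_subsetI insert_subset rangeI)
  show "range cd_of_complex \<subseteq> cd_C (Suc m)"
    unfolding cd_C_def cd_of_complex_def
    by (auto intro!: span_add span_scale simp: span_base)
qed

lemma cd_perp_C_eq: "cd_perp (Suc m) (cd_C (Suc m)) = C_perp"
proof (intro antisym subsetI)
  fix x assume "x \<in> cd_perp (Suc m) (cd_C (Suc m))"
  then have x: "x \<in> cd_carrier (Suc m)" "cd_dot (Suc m) x (cd_of_complex z) = 0" for z
    by (auto simp: cd_perp_def cd_C_eq cd_inner_eq_dot)
  obtain p q where "x = cd_pair m p q" "p \<in> cd_carrier m" "q \<in> cd_carrier m"
    using x(1) by (rule cd_carrier_pair_cases)
  then have "cd_to_complex x = 0"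
    using x(2)[of 1] x(2)[of \<i>]
    by (simp add: cd_of_complex_pair cd_dot_pair cd_dot_one cd_to_complex_def lookup_cd_pair complex_eq_iff)
  then show "x \<in> C_perp"
    using x(1) unfolding C_perp_def by simp
next
  fix x assume "x \<in> C_perp"
  then show "x \<in> cd_perp (Suc m) (cd_C (Suc m))"
    by (auto simp: cd_perp_def cd_C_eq cd_inner_eq_dot dot_of_complex_C_perp)
qed

lemma cd_proj_C_eq_0:
  assumes "x \<in> C_perp"
  shows "cd_proj_C (Suc m) x = 0"
  unfolding cd_proj_C_def
proof (rule the_equality)
  show "0 \<in> cd_C (Suc m) \<and> x - 0 \<in> cd_perp (Suc m) (cd_C (Suc m))"
    using assms subspace_0[OF subspace_span] by (simp add: cd_perp_C_eq) (simp add: cd_C_def)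
  fix c assume c: "c \<in> cd_C (Suc m) \<and> x - c \<in> cd_perp (Suc m) (cd_C (Suc m))"
  then obtain z where z: "c = cd_of_complex z"
    by (auto simp: cd_C_eq)
  then have "x - cd_of_complex z \<in> C_perp"
    using c by (simp add: cd_perp_C_eq)
  from C_perp_to_complex[OF this] show "c = 0"
    using assms z by simp
qed

text \<open>If \<open>P(ab) = 0\<close>, then \<open>a \<star> b\<close> lies in
  \<open>C_perp\<close> and its projection to \<open>cd_C (Suc m)\<close> is 0. The real inner
  products with annihilators vanish as real parts of Hermitian products that are 0.\<close>

lemma brace_in_D_locus:
  assumes "a \<in> C_perp" "a \<noteq> 0" "b \<in> C_perp" "b \<noteq> 0" "D_condition a b"
  shows "cd_brace (Suc m) a b \<in> D_locus (Suc m)"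
proof -
  have "a \<star> b = cd_perp_part (a \<star> b)"
    using assms cd_decomp[of "a \<star> b"] by (simp add: D_condition_def)
  then have "a \<star> b \<in> C_perp"
    by (metis cd_mult_carrier cd_perp_part_C_perp)
  then have "cd_hermitian (Suc m) a b = 0"
    using assms by (simp add: cd_hermitian_def cd_proj_C_eq_0)
  moreover have "cd_inner (Suc m) a y = 0" if "y \<in> cd_Ann (Suc m) b" for y
    using that assms cd_Ann_subset_C_perp[of b]
    by (auto simp: cd_inner_eq_dot dot_eq_Re D_condition_def subset_iff)
  moreover have "cd_inner (Suc m) b y = 0" if "y \<in> cd_Ann (Suc m) a" for y
    using that assms cd_Ann_subset_C_perp[of a]
    by (auto simp: cd_inner_eq_dot dot_eq_Re D_condition_def subset_iff)
  ultimately show ?thesis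
    using assms unfolding D_locus_def cd_perp_C_eq by blast
qed

lemma pair_perp_H:
  assumes "p \<in> C_perp" "q \<in> C_perp"
  shows "cd_pair (Suc m) p q \<in> cd_perp (Suc (Suc m)) (cd_H_Suc (Suc m))"
proof -
  let ?x = "cd_pair (Suc m) p q"
  let ?S = "{y \<in> cd_carrier (Suc (Suc m)). cd_dot (Suc (Suc m)) ?x y = 0}"
  have C: "cd_one = cd_of_complex 1" "cd_i (Suc m) = cd_of_complex \<i>"
    by (auto simp: cd_of_complex_def)
  have "subspace ?S"
    by (auto simp: subspace_def)
  then have "cd_H_Suc (Suc m) \<subseteq> ?S"
    unfolding cd_H_Suc_def C
    by (intro span_minimal) (auto simp: cd_dot_pair assms dot_of_complex_C_perp)
  then show ?thesis
    by (auto simp: cd_perp_def cd_inner_eq_dot)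
qed

lemma Ann_brace:
  "cd_Ann (Suc (Suc m)) (cd_brace (Suc m) a b) =
    cd_Ann (Suc (Suc m)) (cd_pair (Suc m) (a + b) (cd_scale \<i> (b - a)))"
proof -
  have "cd_brace (Suc m) a b = (1 / sqrt 2) *\<^sub>R cd_pair (Suc m) (a + b) (cd_scale \<i> (b - a))"
    by (simp add: cd_brace_def cd_scale_def cd_of_complex_def algebra_simps)
  then show ?thesis
    by (simp add: cd_Ann_def)
qed

end

theorem theorem6p7:
  fixes n :: nat and a b :: cd
  assumes "n \<ge> 1"
    and "a \<in> cd_perp n (cd_C n)" and "b \<in> cd_perp n (cd_C n)"
    and "a \<noteq> 0" and "b \<noteq> 0"
    and "cd_brace n a b \<notin> D_locus n"
  shows "cd_Ann (Suc n) (cd_brace n a b) \<subseteq> cd_perp (Suc n) (cd_H_Suc n) \<and>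
         dim (cd_Ann (Suc n) (cd_brace n a b)) = dim (cd_Ann n a) + dim (cd_Ann n b)"
proof -
  obtain m where n: "n = Suc m"
    using assms(1) by (cases n) auto
  have a: "a \<in> C_perp m" "a \<noteq> 0" and b: "b \<in> C_perp m" "b \<noteq> 0"
    using assms by (auto simp: n cd_perp_C_eq)
  have D: "\<not> D_condition m a b"
    using assms(6) brace_in_D_locus[OF a b] by (auto simp: n)
  show ?thesis
  proof
    show "cd_Ann (Suc n) (cd_brace n a b) \<subseteq> cd_perp (Suc n) (cd_H_Suc n)"
      unfolding n Ann_brace Ann_brace_eq[OF a b D]
      by (auto simp: annihilator_pairs_def intro!: pair_perp_H)
    show "dim (cd_Ann (Suc n) (cd_brace n a b)) = dim (cd_Ann n a) + dim (cd_Ann n b)"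
      unfolding n Ann_brace by (rule dim_Ann_brace[OF a b D])
  qed
qed

end
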